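(* Let $\varphi_1,\dots,\varphi_N$ be contractive similitudes of $\mathbb{R}^d$, and let $C=\bigcup_{j=1}^m C_j\subset\mathbb{R}^d$ be a disjoint union of arcs $C_1,\dots,C_m$ with $m\ge 2$. Let $K$ be the attractor of the IFS with condensation $\mathcal{S}=\{C;\varphi_1,\dots,\varphi_N\}$, i.e. the unique nonempty compact set with $K=C\cup\bigcup_{i=1}^N\varphi_i(K)$, and let $E$ be the attractor of the IFS $\{\varphi_i\}_{i=1}^N$, i.e. the unique nonempty compact set with $E=\bigcup_{i=1}^N\varphi_i(E)$. Suppose that: (i) $K$ is an arc; (ii) the arc $K$ can be decomposed into $\gamma_1+\gamma_2+\cdots+\gamma_{m+N}$, where $\gamma_1,\dots,\gamma_{m+N}$ is a rearrangement of $C_1,\dots,C_m,\varphi_1(K),\dots,\varphi_N(K)$ such that $\gamma_1,\gamma_{m+N}\in\{C_1,\dots,C_m\}$; (iii) $\dim_H E>1$. Then $K$ is a Whitney set.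
   Context: An arc is a homeomorphic image of $[0,1]$. An arc $\gamma$ can be decomposed into $\gamma_1+\gamma_2+\cdots+\gamma_n$ if all $\gamma_\ell$ are subarcs of $\gamma$ and $\gamma$ is the joining of $\gamma_1,\gamma_2,\dots,\gamma_n$ in this order (consecutive subarcs meet exactly at a common endpoint and their union is $\gamma$). A contractive similitude of $\mathbb{R}^d$ is a map $\varphi$ with $|\varphi(x)-\varphi(y)|=\rho|x-y|$ for all $x,y$, for some $\rho\in(0,1)$ (orientation reversing maps are allowed). A compact connected set $F\subset\mathbb{R}^d$ is a Whitney set if there is a $C^1$ function $f:\mathbb{R}^d\to\mathbb{R}$ such that $\nabla f(x)=0$ for all $x\in F$ and $f|_F$ is not constant. $\dim_H$ denotes Hausdorff dimension. *)

theory Defs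
  imports "HOL-Analysis.Analysis" "HOL-Library.Multiset"
begin

definition is_arc :: "'a::topological_space set \<Rightarrow> bool" where
  "is_arc A \<longleftrightarrow> {0..1::real} homeomorphic A"

definition arc_from_to :: "'a::topological_space set \<Rightarrow> 'a \<Rightarrow> 'a \<Rightarrow> bool" where
  "arc_from_to A a b \<longleftrightarrow> (\<exists>g. arc g \<and> path_image g = A \<and> pathstart g = a \<and> pathfinish g = b)"

text \<open>
  \<open>A = G 1 + \<dots> + G n\<close>: the \<open>l\<close>-th subarc runs from \<open>p (l - 1)\<close> to \<open>p l\<close>, so that the
  subarcs are joined head to tail in the given order.
\<close>
definition arc_decomposition :: "'a::topological_space set \<Rightarrow> (nat \<Rightarrow> 'a set) \<Rightarrow> nat \<Rightarrow> bool" where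
  "arc_decomposition A G n \<longleftrightarrow>
     is_arc A \<and>
     (\<exists>p. (\<forall>l\<in>{1..n}. G l \<subseteq> A \<and> arc_from_to (G l) (p (l - 1)) (p l)) \<and>
          (\<forall>l\<in>{1..<n}. G l \<inter> G (Suc l) = {p l}) \<and>
          (\<Union>l\<in>{1..n}. G l) = A)"

definition contractive_similitude :: "('a::metric_space \<Rightarrow> 'a) \<Rightarrow> bool" where
  "contractive_similitude f \<longleftrightarrow> (\<exists>\<rho>\<in>{0<..<1}. \<forall>x y. dist (f x) (f y) = \<rho> * dist x y)"

definition ifs_attractor :: "nat \<Rightarrow> (nat \<Rightarrow> 'a \<Rightarrow> 'a) \<Rightarrow> 'a::topological_space set \<Rightarrow> bool" where
  "ifs_attractor N \<phi> E \<longleftrightarrow> compact E \<and> E \<noteq> {} \<and> E = (\<Union>i\<in>{1..N}. \<phi> i ` E)"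

definition condensation_attractor ::
    "'a set \<Rightarrow> nat \<Rightarrow> (nat \<Rightarrow> 'a \<Rightarrow> 'a) \<Rightarrow> 'a::topological_space set \<Rightarrow> bool" where
  "condensation_attractor C N \<phi> K \<longleftrightarrow>
     compact K \<and> K \<noteq> {} \<and> K = C \<union> (\<Union>i\<in>{1..N}. \<phi> i ` K)"

definition whitney_set :: "'a::real_inner set \<Rightarrow> bool" where
  "whitney_set F \<longleftrightarrow> compact F \<and> connected F \<and>
     (\<exists>f grad. (\<forall>x. GDERIV f x :> grad x) \<and> continuous_on UNIV grad \<and>
               (\<forall>x\<in>F. grad x = 0) \<and> \<not> f constant_on F)"

text \<open>
  \<open>diam U ^ s\<close>, where \<open>{}\<close> contributes \<open>0\<close> and a nonempty set contributes \<open>1\<close> for \<open>s = 0\<close>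
  (note that \<open>0 powr 0 = 0\<close>, and that \<^const>\<open>diameter\<close> is meaningful on bounded sets only).
\<close>
definition diam_pow :: "real \<Rightarrow> 'a::metric_space set \<Rightarrow> ennreal" where
  "diam_pow s U =
     (if U = {} then 0 else if s = 0 then 1 else ennreal (diameter U powr s))"

definition hausdorff_premeasure :: "real \<Rightarrow> real \<Rightarrow> 'a::metric_space set \<Rightarrow> ennreal" where
  "hausdorff_premeasure s \<delta> A =
     Inf {(\<Sum>i. diam_pow s (U i)) | U :: nat \<Rightarrow> 'a set.
            A \<subseteq> (\<Union>i. U i) \<and> (\<forall>i. bounded (U i) \<and> diameter (U i) \<le> \<delta>)}"

definition hausdorff_measure :: "real \<Rightarrow> 'a::metric_space set \<Rightarrow> ennreal" where
  "hausdorff_measure s A = (SUP \<delta>\<in>{0<..}. hausdorff_premeasure s \<delta> A)"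

definition hausdorff_dim :: "'a::metric_space set \<Rightarrow> ennreal" where
  "hausdorff_dim A = Inf {ennreal s | s. 0 \<le> s \<and> hausdorff_measure s A = 0}"

end

theory Submission imports Defs begin

text \<open>
  Let \<open>\<rho>\<^sub>i\<close> be the ratio of \<open>\<phi>\<^sub>i\<close>. If \<open>\<Sum> \<rho>\<^sub>i \<le> 1\<close>, then the images of \<open>E\<close> under the words of
  length \<open>k\<close> in the \<open>\<phi>\<^sub>i\<close> are covers which show that \<open>E\<close> has \<open>s\<close>-dimensional measure \<open>0\<close> for every
  \<open>s > 1\<close>. Hence \<open>dim\<^sub>H E > 1\<close> forces \<open>R = \<Sum> \<rho>\<^sub>i > 1\<close> (\<open>sum_ratios_gt_1\<close>), and the numbers
  \<open>p\<^sub>i = \<rho>\<^sub>i / R\<close> are weights of sum \<open>1\<close> with \<open>p\<^sub>i / \<rho>\<^sub>i = 1 / R < 1\<close>.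

  The Whitney function is a devil's staircase along \<open>K\<close>: it goes from \<open>-1\<close> to \<open>1\<close>, stays constant
  on the pieces \<open>C\<^sub>j\<close>, and climbs by \<open>2 p\<^sub>i\<close> along \<open>\<phi>\<^sub>i(K)\<close>, where it repeats itself, scaled by \<open>p\<^sub>i\<close>.
  Passing to the copy \<open>\<phi>\<^sub>i(K)\<close> multiplies values by \<open>p\<^sub>i\<close> but lengths by \<open>\<rho>\<^sub>i\<close>, so slopes are
  multiplied by \<open>1 / R\<close> at each level, and the gradient has to vanish on \<open>K\<close>.

  The staircase and its extension to the whole space are obtained at once, without an extension
  theorem, as the fixed point of
  \<open>F \<mapsto> \<Sum> q\<^sub>i (\<eta>\<^sub>i (F \<circ> \<phi>\<^sub>i\<^sup>-\<^sup>1) + (1 - \<eta>\<^sub>i) \<psi>\<^sub>i)\<close> with \<open>q\<^sub>i = \<plusminus> p\<^sub>i\<close>.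
  Here \<open>\<psi>\<^sub>i\<close> is a \<open>C\<^sup>1\<close> function that is \<open>-1\<close> on one side of the copy \<open>\<phi>\<^sub>i(K)\<close> and \<open>1\<close> on the other,
  the sign of \<open>q\<^sub>i\<close> records the orientation of \<open>\<phi>\<^sub>i\<close>, and the cutoffs \<open>\<eta>\<^sub>i\<close> are \<open>1\<close> on the image of the
  middle part of \<open>K\<close>, have disjoint supports and vanish on \<open>K\<close> outside \<open>\<phi>\<^sub>i(K)\<close>. On the
  images of the two end pieces of \<open>K\<close>, where \<open>\<eta>\<^sub>i\<close> descends from \<open>1\<close> to \<open>0\<close>, the functions
  \<open>F \<circ> \<phi>\<^sub>i\<^sup>-\<^sup>1\<close> and \<open>\<psi>\<^sub>i\<close> are the same constant \<open>\<plusminus> 1\<close>, so that the transition is not felt on \<open>K\<close>. This is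
  the point of requiring that the first and the last piece of \<open>K\<close> are not copies: the staircase is
  constant on them, so each copy starts and ends with a flat part, and the parts of neighbouring copies
  on which it is not constant keep a positive distance even if the copies touch.
  Since the operator contracts values and, up to a term controlled by the values, gradients by the
  factor \<open>1 / R\<close>, its iterates converge in \<open>C\<^sup>1\<close> (\<open>self_similar_C1_function\<close>).

  All that is needed of the topology of \<open>K\<close> is a continuous injective \<open>h : K \<rightarrow> \<real>\<close> that carries the
  pieces to consecutive intervals (\<open>decomposition_chart\<close>).
\<close>

section \<open>Functions of class \<open>C\<^sup>1\<close> with explicit gradient\<close>

definition C1_with_gradient :: "('a::real_inner \<Rightarrow> real) \<Rightarrow> ('a \<Rightarrow> 'a) \<Rightarrow> bool" where
  "C1_with_gradient f g \<longleftrightarrow> (\<forall>x. GDERIV f x :> g x) \<and> continuous_on UNIV g"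

lemma C1_with_gradient_continuous: "C1_with_gradient f g \<Longrightarrow> continuous_on UNIV f"
  unfolding C1_with_gradient_def gderiv_def
  by (auto intro!: continuous_at_imp_continuous_on has_derivative_continuous)

lemma C1_with_gradient_const: "C1_with_gradient (\<lambda>x. c) (\<lambda>x. 0)"
  by (simp add: C1_with_gradient_def GDERIV_const)

lemma C1_with_gradient_add:
  "C1_with_gradient f g \<Longrightarrow> C1_with_gradient f' g' \<Longrightarrow> C1_with_gradient (\<lambda>x. f x + f' x) (\<lambda>x. g x + g' x)"
  by (auto simp: C1_with_gradient_def intro: GDERIV_add continuous_intros)

lemma C1_with_gradient_diff:
  "C1_with_gradient f g \<Longrightarrow> C1_with_gradient f' g' \<Longrightarrow> C1_with_gradient (\<lambda>x. f x - f' x) (\<lambda>x. g x - g' x)"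
  by (auto simp: C1_with_gradient_def intro: GDERIV_diff continuous_intros)

lemma C1_with_gradient_mult:
  assumes "C1_with_gradient f g" "C1_with_gradient f' g'"
  shows "C1_with_gradient (\<lambda>x. f x * f' x) (\<lambda>x. f x *\<^sub>R g' x + f' x *\<^sub>R g x)"
  using assms C1_with_gradient_continuous[OF assms(1)] C1_with_gradient_continuous[OF assms(2)]
  by (auto simp: C1_with_gradient_def intro!: GDERIV_mult continuous_intros)

lemma C1_with_gradient_cmult:
  "C1_with_gradient f g \<Longrightarrow> C1_with_gradient (\<lambda>x. c * f x) (\<lambda>x. c *\<^sub>R g x)"
  using C1_with_gradient_mult[OF C1_with_gradient_const[of c]] by fastforce

lemma C1_with_gradient_sum:
  assumes "finite I" and "\<And>i. i \<in> I \<Longrightarrow> C1_with_gradient (f i) (g i)"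
  shows "C1_with_gradient (\<lambda>x. \<Sum>i\<in>I. f i x) (\<lambda>x. \<Sum>i\<in>I. g i x)"
  using assms
  by (induction I rule: finite_induct) (auto intro: C1_with_gradient_const C1_with_gradient_add)

lemma C1_with_gradient_compose:
  assumes "C1_with_gradient f g" and "\<And>t. DERIV h t :> h' t" and "continuous_on UNIV h'"
  shows "C1_with_gradient (\<lambda>x. h (f x)) (\<lambda>x. h' (f x) *\<^sub>R g x)"
  unfolding C1_with_gradient_def
proof (intro conjI allI)
  show "GDERIV (\<lambda>x. h (f x)) x :> h' (f x) *\<^sub>R g x" for x
    using assms by (intro GDERIV_DERIV_compose) (auto simp: C1_with_gradient_def)
  show "continuous_on UNIV (\<lambda>x. h' (f x) *\<^sub>R g x)"
    using assms C1_with_gradient_continuous[OF assms(1)]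
    by (auto simp: C1_with_gradient_def intro!: continuous_on_scaleR continuous_on_compose2[of UNIV h'])
qed

text \<open>
  This is how gradients are seen to vanish below: cutoffs and step functions attain an extremal value
  wherever they are required to be constant on \<open>K\<close>.
\<close>
lemma gradient_at_global_extremum:
  assumes "C1_with_gradient f g" and "(\<forall>y. f y \<le> f x) \<or> (\<forall>y. f x \<le> f y)"
  shows "g x = 0"
proof -
  have "(f has_derivative (\<lambda>h. h \<bullet> g x)) (at x)"
    using assms(1) by (simp add: C1_with_gradient_def gderiv_def)
  then have "(\<lambda>h. h \<bullet> g x) = (\<lambda>h. 0)"
    using assms(2) by (intro differential_zero_maxmin[of x UNIV f]) auto
  then show ?thesis by (metis inner_eq_zero_iff)
qed

text \<open>
  The square of the positive part is the simplest \<open>C\<^sup>1\<close> function with a one-sided zero set; all bumps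
  are built from it.
\<close>
lemma pos_part_square_DERIV: "DERIV (\<lambda>t::real. (max 0 t)\<^sup>2) t :> 2 * max 0 t"
proof -
  consider "t < 0" | "t = 0" | "t > 0" by linarith
  then show ?thesis
  proof cases
    case 1
    have "DERIV (\<lambda>t::real. 0) t :> 2 * max 0 t" using 1 by simp
    then show ?thesis
      by (rule has_field_derivative_transform_within_open[of _ _ _ "{..<0}"]) (use 1 in auto)
  next
    case 3
    have "DERIV (\<lambda>t::real. t\<^sup>2) t :> 2 * max 0 t" using 3 by (auto intro!: derivative_eq_intros)
    then show ?thesis
      by (rule has_field_derivative_transform_within_open[of _ _ _ "{0<..}"]) (use 3 in auto)
  next
    case 2
    have "((\<lambda>y::real. max 0 y * (max 0 y / y)) \<longlongrightarrow> 0) (at 0)"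
    proof (rule Lim_null_comparison)
      show "\<forall>\<^sub>F y in at 0. norm (max 0 y * (max 0 y / y)) \<le> \<bar>y\<bar>" for y::real
        by (rule always_eventually) (auto simp: max_def)
      show "((\<lambda>y::real. \<bar>y\<bar>) \<longlongrightarrow> 0) (at 0)" 
        by (rule tendsto_rabs_zero) (rule tendsto_ident_at)
    qed
    then show ?thesis using 2 by (simp add: has_field_derivative_iff power2_eq_square)
  qed
qed

text \<open>
  With \<open>p t = (max 0 t)\<^sup>2\<close>, the function \<open>t \<mapsto> p (1 - p (t - 1))\<close> is \<open>1\<close> for \<open>t \<le> 1\<close> and \<open>0\<close> for
  \<open>t \<ge> 2\<close>; it is applied to the squared distance from \<open>a\<close> in units of \<open>r\<close>.
\<close>
lemma C1_bump_ball:
  fixes a :: "'a::euclidean_space"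
  assumes "r > 0"
  shows "\<exists>f g. C1_with_gradient f g \<and> range f \<subseteq> {0..1} \<and> (\<forall>x\<in>cball a r. f x = 1) \<and> (\<forall>x. x \<notin> ball a (2 * r) \<longrightarrow> f x = 0)"
proof -
  define p where "p t = (max 0 t)\<^sup>2" for t :: real
  have p': "DERIV p t :> 2 * max 0 t" for t
    unfolding p_def by (rule pos_part_square_DERIV)
  define c where "c = 1 / r\<^sup>2"
  define q where "q x = c * ((x - a) \<bullet> (x - a))" for x
  have "GDERIV q x :> (2 * c) *\<^sub>R (x - a)" for x
    unfolding q_def gderiv_def
    by (auto intro!: derivative_eq_intros simp: inner_commute)
  then have q: "C1_with_gradient q (\<lambda>x. (2 * c) *\<^sub>R (x - a))"
    by (auto simp: C1_with_gradient_def intro!: continuous_intros)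
  have p1: "DERIV (\<lambda>t. p (t - 1)) t :> 2 * max 0 (t - 1)" for t
    using DERIV_shift[of p "2 * max 0 (t - 1)" t "-1"] p'[of "t - 1"] by simp
  have "C1_with_gradient (\<lambda>x. p (q x - 1)) (\<lambda>x. (2 * max 0 (q x - 1)) *\<^sub>R ((2 * c) *\<^sub>R (x - a)))"
    by (rule C1_with_gradient_compose[OF q p1]) (intro continuous_intros)
  from C1_with_gradient_compose[OF C1_with_gradient_diff[OF C1_with_gradient_const[of 1] this] p']
  obtain g where g: "C1_with_gradient (\<lambda>x. p (1 - p (q x - 1))) g"
    by (fastforce intro: continuous_intros)
  have "p (1 - p t) \<in> {0..1}" for t
    by (auto simp: p_def power_le_one max_def)
  moreover have "p (1 - p (q x - 1)) = 1" if "x \<in> cball a r" for x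
  proof -
    have "(norm (x - a))\<^sup>2 \<le> r\<^sup>2" using that by (intro power_mono) (auto simp: dist_norm norm_minus_commute)
    then have "q x \<le> 1" using \<open>r > 0\<close> by (simp add: q_def c_def power2_norm_eq_inner)
    then show ?thesis by (simp add: p_def)
  qed
  moreover have "p (1 - p (q x - 1)) = 0" if "x \<notin> ball a (2 * r)" for x
  proof -
    have "(2 * r)\<^sup>2 \<le> (norm (x - a))\<^sup>2" using that \<open>r > 0\<close> by (intro power_mono) (auto simp: dist_norm norm_minus_commute)
    then have "q x \<ge> 4" using \<open>r > 0\<close> by (simp add: q_def c_def power2_norm_eq_inner pos_le_divide_eq power_mult_distrib)
    then have "(max 0 (q x - 1))\<^sup>2 \<ge> 1" by (intro one_le_power) simp
    then show ?thesis by (simp add: p_def)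
  qed
  ultimately show ?thesis using g by (intro exI[of _ "\<lambda>x. p (1 - p (q x - 1))"] exI[of _ g]) auto
qed

text \<open>
  Compactness reduces the claim to finitely many balls, and cutoffs \<open>f\<close>, \<open>f'\<close> for two sets combine to
  the cutoff \<open>1 - (1 - f) (1 - f')\<close> for their union.
\<close>
lemma C1_urysohn:
  fixes S U :: "'a::euclidean_space set"
  assumes "compact S" "open U" "S \<subseteq> U"
  shows "\<exists>f g. C1_with_gradient f g \<and> range f \<subseteq> {0..1} \<and> (\<forall>x\<in>S. f x = 1) \<and> (\<forall>x. x \<notin> U \<longrightarrow> f x = 0)"
proof -
  define good where "good T \<longleftrightarrow> (\<exists>f g. C1_with_gradient f g \<and> range f \<subseteq> {0..1} \<and> (\<forall>x\<in>T. f x = 1) \<and> (\<forall>x. x \<notin> U \<longrightarrow> f x = 0))"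
    for T :: "'a set"
  have good_Un: "good (T \<union> T')" if T: "good T" and T': "good T'" for T T'
  proof -
    obtain f g where f: "C1_with_gradient f g" "range f \<subseteq> {0..1}" "\<forall>x\<in>T. f x = 1" "\<forall>x. x \<notin> U \<longrightarrow> f x = 0"
      using T unfolding good_def by blast
    obtain f' g' where f': "C1_with_gradient f' g'" "range f' \<subseteq> {0..1}" "\<forall>x\<in>T'. f' x = 1" "\<forall>x. x \<notin> U \<longrightarrow> f' x = 0"
      using T' unfolding good_def by blast
    note one = C1_with_gradient_const[of 1]
    note C1 = C1_with_gradient_diff[OF one C1_with_gradient_mult[OF C1_with_gradient_diff[OF one f(1)] C1_with_gradient_diff[OF one f'(1)]]]
    have "0 \<le> (1 - f x) * (1 - f' x)" "(1 - f x) * (1 - f' x) \<le> 1" for x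
      using f(2) f'(2) by (auto intro!: mult_nonneg_nonneg mult_le_one simp: image_subset_iff)
    then show ?thesis
      unfolding good_def using f f' by (intro exI conjI) (rule C1, auto)
  qed
  have good_empty: "good {}"
    unfolding good_def by (rule exI[of _ "\<lambda>x. 0"], rule exI[of _ "\<lambda>x. 0"]) (auto intro: C1_with_gradient_const)
  have "\<exists>r>0. ball a (2 * r) \<subseteq> U" if "a \<in> S" for a
  proof -
    obtain e where "e > 0" "ball a e \<subseteq> U" using assms \<open>a \<in> S\<close> by (meson open_contains_ball subsetD)
    then show ?thesis by (intro exI[of _ "e / 2"]) auto
  qed
  then obtain r where r: "\<And>a. a \<in> S \<Longrightarrow> r a > 0 \<and> ball a (2 * r a) \<subseteq> U" by metis
  have "S \<subseteq> (\<Union>a\<in>S. ball a (r a))" using r by force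
  then obtain D where D: "D \<subseteq> S" "finite D" "S \<subseteq> (\<Union>a\<in>D. ball a (r a))"
    using compactE_image[OF \<open>compact S\<close>, of S "\<lambda>a. ball a (r a)"] by auto
  have "good (\<Union>a\<in>D. cball a (r a))"
    using D(2,1)
  proof (induction D rule: finite_induct)
    case empty
    then show ?case using good_empty by simp
  next
    case (insert a D)
    have "good (cball a (r a))"
      using C1_bump_ball[of "r a" a] r[of a] insert.prems unfolding good_def by (meson insert_subset subsetD)
    then show ?case using insert good_Un by simp
  qed
  moreover have "S \<subseteq> (\<Union>a\<in>D. cball a (r a))" using D(3) ball_subset_cball by blast
  ultimately show ?thesis unfolding good_def by blast
qed

text \<open>
  Off \<open>U\<close> the function is minimal, so its gradient vanishes there; on the compact closure of \<open>U\<close> it is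
  bounded by continuity.
\<close>
lemma gradient_bounded_of_bounded_support:
  fixes U :: "'a::euclidean_space set"
  assumes "C1_with_gradient f g" "range f \<subseteq> {0..1}" "\<And>x. x \<notin> U \<Longrightarrow> f x = 0" "bounded U"
  shows "\<exists>B. \<forall>x. norm (g x) \<le> B"
proof -
  have zero: "g x = 0" if "x \<notin> U" for x
    using assms(2) assms(3)[OF that] by (intro gradient_at_global_extremum[OF assms(1)]) (auto simp: image_subset_iff)
  have "compact (g ` closure U)"
    using assms(1,4) by (intro compact_continuous_image) (auto simp: C1_with_gradient_def compact_closure intro: continuous_on_subset)
  then obtain B where "\<And>x. x \<in> closure U \<Longrightarrow> norm (g x) \<le> B"
    by (meson bounded_iff compact_imp_bounded imageI)
  then have "norm (g x) \<le> max 0 B" for x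
    by (cases "x \<in> U") (use zero closure_subset[of U] in fastforce)+
  then show ?thesis by blast
qed

lemma C1_separation:
  fixes S T :: "'a::euclidean_space set"
  assumes "compact S" "compact T" "S \<inter> T = {}"
  shows "\<exists>f g B. C1_with_gradient f g \<and> range f \<subseteq> {-1..1} \<and> (\<forall>x\<in>S. f x = -1) \<and> (\<forall>x\<in>T. f x = 1)
           \<and> (\<forall>x. norm (g x) \<le> B)"
proof -
  obtain R where R: "T \<subseteq> ball 0 R" using compact_imp_bounded[OF assms(2)] bounded_subset_ballD by blast
  obtain f g where fg: "C1_with_gradient f g" "range f \<subseteq> {0..1}" "\<forall>x\<in>T. f x = 1" "\<And>x. x \<notin> ball 0 R - S \<Longrightarrow> f x = 0"
  proof -
    have "open (ball 0 R - S)" "T \<subseteq> ball 0 R - S"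
      using assms R compact_imp_closed by (auto intro: open_Diff)
    from C1_urysohn[OF assms(2) this] show ?thesis using that by blast
  qed
  obtain B where B: "\<And>x. norm (g x) \<le> B"
    using gradient_bounded_of_bounded_support[OF fg(1,2,4)] bounded_subset[OF bounded_ball Diff_subset] by blast
  have "C1_with_gradient (\<lambda>x. 2 * f x - 1) (\<lambda>x. 2 *\<^sub>R g x - 0)"
    by (intro C1_with_gradient_diff C1_with_gradient_cmult C1_with_gradient_const fg)
  moreover have "\<forall>x. norm (2 *\<^sub>R g x - 0) \<le> 2 * B" using B by simp
  moreover have "0 \<le> f x" "f x \<le> 1" for x using fg(2) by (auto simp: image_subset_iff)
  ultimately show ?thesis using fg(3,4) by (intro exI[of _ "\<lambda>x. 2 * f x - 1"] exI[of _ "\<lambda>x. 2 *\<^sub>R g x - 0"] exI[of _ "2 * B"]) auto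
qed

text \<open>
  Disjoint supports come from Voronoi-type neighbourhoods: the points closer to \<open>J i\<close> than to \<open>Z i\<close>.
  As \<open>Z i\<close> contains every other \<open>J j\<close>, a point of two such neighbourhoods would be closer to each of two
  sets than to the other.
\<close>
lemma disjoint_C1_cutoffs:
  fixes J Z :: "'i \<Rightarrow> 'a::euclidean_space set"
  assumes J: "\<And>i. i \<in> I \<Longrightarrow> compact (J i)" "\<And>i. i \<in> I \<Longrightarrow> J i \<noteq> {}"
    and Z: "\<And>i. i \<in> I \<Longrightarrow> closed (Z i)" "\<And>i. i \<in> I \<Longrightarrow> Z i \<noteq> {}"
    and JZ: "\<And>i. i \<in> I \<Longrightarrow> J i \<inter> Z i = {}" "\<And>i j. i \<in> I \<Longrightarrow> j \<in> I \<Longrightarrow> i \<noteq> j \<Longrightarrow> J j \<subseteq> Z i"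
  shows "\<exists>\<eta> X B. (\<forall>i\<in>I. C1_with_gradient (\<eta> i) (X i) \<and> range (\<eta> i) \<subseteq> {0..1::real} \<and> (\<forall>x. norm (X i x) \<le> B i) \<and>
      (\<forall>x\<in>J i. \<eta> i x = 1) \<and> (\<forall>x\<in>Z i. \<eta> i x = 0)) \<and>
      (\<forall>i\<in>I. \<forall>j\<in>I. \<forall>x. i \<noteq> j \<longrightarrow> \<eta> i x = 0 \<or> \<eta> j x = 0)"
proof -
  define V where "V i = {x. infdist x (J i) < infdist x (Z i)}" for i
  have disj: "V i \<inter> V j = {}" if "i \<in> I" "j \<in> I" "i \<noteq> j" for i j
  proof -
    have "infdist x (Z i) \<le> infdist x (J j)" "infdist x (Z j) \<le> infdist x (J i)" for x
      using JZ(2) J(2) that by (auto intro!: infdist_mono)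
    then show ?thesis unfolding V_def by (smt (verit) disjoint_iff mem_Collect_eq)
  qed
  have "\<exists>f g B. C1_with_gradient f g \<and> range f \<subseteq> {0..1::real} \<and> (\<forall>x. norm (g x) \<le> B) \<and> (\<forall>x\<in>J i. f x = 1) \<and> (\<forall>x. x \<notin> V i \<longrightarrow> f x = 0)"
    if i: "i \<in> I" for i
  proof -
    obtain R where R: "J i \<subseteq> ball 0 R"
      using compact_imp_bounded[OF J(1)[OF i]] bounded_subset_ballD by blast
    have "infdist x (J i) < infdist x (Z i)" if "x \<in> J i" for x
    proof -
      have "x \<notin> Z i" using that JZ(1)[OF i] by blast
      then have "infdist x (Z i) \<noteq> 0" using in_closed_iff_infdist_zero Z i by metis
      then show ?thesis using that infdist_nonneg[of x "Z i"] by simp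
    qed
    then have sub: "J i \<subseteq> V i \<inter> ball 0 R" using R unfolding V_def by blast
    have "open (V i \<inter> ball 0 R)"
      unfolding V_def by (intro open_Int open_ball open_Collect_less continuous_intros)
    from C1_urysohn[OF J(1)[OF i] this sub]
    obtain f g where f: "C1_with_gradient f g" "range f \<subseteq> {0..1}" "\<forall>x\<in>J i. f x = 1"
       "\<And>x. x \<notin> V i \<inter> ball 0 R \<Longrightarrow> f x = 0" by blast
    obtain B where "\<forall>x. norm (g x) \<le> B"
      using gradient_bounded_of_bounded_support[OF f(1,2,4)] bounded_subset[OF bounded_ball Int_lower2] by blast
    with f show ?thesis by blast
  qed
  then obtain \<eta> X B where \<eta>: "\<And>i. i \<in> I \<Longrightarrow> C1_with_gradient (\<eta> i) (X i) \<and> range (\<eta> i) \<subseteq> {0..1::real} \<and> (\<forall>x. norm (X i x) \<le> B i) \<and> (\<forall>x\<in>J i. \<eta> i x = 1) \<and> (\<forall>x. x \<notin> V i \<longrightarrow> \<eta> i x = 0)"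
    by metis
  have "x \<notin> V i" if "x \<in> Z i" for x i
    using that infdist_nonneg[of x "J i"] by (simp add: V_def)
  then show ?thesis
    using \<eta> disj by (intro exI[of _ \<eta>] exI[of _ X] exI[of _ B]) (metis disjoint_iff)
qed

text \<open>
  A similitude of a Euclidean space is \<open>x \<mapsto> \<phi> 0 + \<rho> Q x\<close> with \<open>Q\<close> orthogonal. By the chain rule the
  gradient of \<open>f \<circ> \<phi>\<^sup>-\<^sup>1\<close> is the transported gradient of \<open>f\<close>, lengthened by \<open>1 / \<rho>\<close>.
\<close>
lemma similitude_inverse:
  fixes \<phi> :: "'a::euclidean_space \<Rightarrow> 'a"
  assumes sim: "\<And>x y. dist (\<phi> x) (\<phi> y) = \<rho> * dist x y" and "\<rho> > 0"
  obtains \<tau> T where "\<And>x. \<tau> (\<phi> x) = x" "linear T" "\<And>v. norm (T v) = norm v / \<rho>"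
    "\<And>f g. C1_with_gradient f g \<Longrightarrow> C1_with_gradient (\<lambda>x. f (\<tau> x)) (\<lambda>x. T (g (\<tau> x)))"
proof -
  define Q where "Q x = (\<phi> x - \<phi> 0) /\<^sub>R \<rho>" for x
  have "dist (Q x) (Q y) = dist x y" for x y
  proof -
    have "Q x - Q y = (\<phi> x - \<phi> y) /\<^sub>R \<rho>" by (simp add: Q_def algebra_simps)
    then show ?thesis using sim[of x y] \<open>\<rho> > 0\<close> by (simp add: dist_norm)
  qed
  then have Q: "orthogonal_transformation Q"
    by (simp add: orthogonal_transformation_isometry) (simp add: Q_def)
  define P where "P = inv Q"
  have P: "orthogonal_transformation P" unfolding P_def by (rule orthogonal_transformation_inv[OF Q])
  have PQ: "P (Q x) = x" and QP: "Q (P x) = x" for x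
    using orthogonal_transformation_bij[OF Q] unfolding P_def bij_def by (simp_all add: surj_f_inv_f)
  have adj: "P v \<bullet> w = v \<bullet> Q w" for v w
    using P PQ unfolding orthogonal_transformation_def by metis
  have linP: "bounded_linear P" using P linear_conv_bounded_linear orthogonal_transformation_linear by blast
  have linQ: "bounded_linear Q" using Q linear_conv_bounded_linear orthogonal_transformation_linear by blast
  define \<tau> where "\<tau> y = P ((y - \<phi> 0) /\<^sub>R \<rho>)" for y
  define T where "T v = Q v /\<^sub>R \<rho>" for v
  have \<tau>': "(\<tau> has_derivative (\<lambda>h. P (h /\<^sub>R \<rho>))) (at x)" for x
    unfolding \<tau>_def by (rule bounded_linear.has_derivative[OF linP]) (auto intro!: derivative_eq_intros)
  have "continuous_on UNIV \<tau>"
    by (auto intro!: continuous_at_imp_continuous_on has_derivative_continuous \<tau>')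
  moreover have "GDERIV (\<lambda>x. f (\<tau> x)) x :> T (g (\<tau> x))" if "C1_with_gradient f g" for f g x
  proof -
    have "(f has_derivative (\<lambda>h. h \<bullet> g (\<tau> x))) (at (\<tau> x))"
      using that by (simp add: C1_with_gradient_def gderiv_def)
    from has_derivative_compose[OF \<tau>' this]
    show ?thesis unfolding gderiv_def by (simp add: adj T_def)
  qed
  ultimately have "C1_with_gradient (\<lambda>x. f (\<tau> x)) (\<lambda>x. T (g (\<tau> x)))" if "C1_with_gradient f g" for f g
    using that unfolding C1_with_gradient_def T_def
    by (auto intro!: continuous_intros bounded_linear.continuous_on[OF linQ] intro: continuous_on_compose2)
  moreover have "\<tau> (\<phi> x) = x" for x
    using PQ[of x] by (simp add: \<tau>_def Q_def)
  moreover have "linear T"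
    unfolding T_def using linear_compose_scale_right[OF orthogonal_transformation_linear[OF Q]] by blast
  moreover have "norm (T v) = norm v / \<rho>" for v
    using \<open>\<rho> > 0\<close> orthogonal_transformation_norm[OF Q] by (simp add: T_def divide_inverse mult.commute)
  ultimately show ?thesis using that by blast
qed

section \<open>Self-similar \<open>C\<^sup>1\<close> functions\<close>

lemma uniform_limit_of_geometric_steps:
  fixes f :: "nat \<Rightarrow> 'a \<Rightarrow> 'b::banach"
  assumes "\<And>n x. norm (f (Suc n) x - f n x) \<le> A * \<kappa> ^ n" and "0 \<le> \<kappa>" "\<kappa> < 1"
  shows "\<exists>l. uniform_limit UNIV f l sequentially"
proof -
  have "summable (\<lambda>n. A * \<kappa> ^ n)"
    using assms by (intro summable_mult summable_geometric) auto
  then have "uniform_limit UNIV (\<lambda>n x. \<Sum>i<n. f (Suc i) x - f i x) (\<lambda>x. \<Sum>i. f (Suc i) x - f i x) sequentially"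
    by (rule Weierstrass_m_test[OF assms(1)])
  then have "uniform_limit UNIV (\<lambda>n x. f 0 x + (\<Sum>i<n. f (Suc i) x - f i x)) 
      (\<lambda>x. f 0 x + (\<Sum>i. f (Suc i) x - f i x)) sequentially"
    by (intro uniform_limit_add uniform_limit_const)
  moreover have "(\<Sum>i<n. f (Suc i) x - f i x) = f n x - f 0 x" for n x
    by (rule sum_lessThan_telescope)
  ultimately show ?thesis by auto
qed

text \<open>
  Geometric steps make both the functions and their gradients converge uniformly, and then the limit of
  the gradients is the gradient of the limit.
\<close>
lemma C1_limit_of_geometric_steps:
  fixes F :: "nat \<Rightarrow> 'a::euclidean_space \<Rightarrow> real"
  assumes C1: "\<And>n. C1_with_gradient (F n) (G n)"
    and "\<And>n x. \<bar>F (Suc n) x - F n x\<bar> \<le> D * \<kappa> ^ n"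
    and "\<And>n x. norm (G (Suc n) x - G n x) \<le> A * \<kappa> ^ n"
    and "0 \<le> \<kappa>" "\<kappa> < 1"
  shows "\<exists>F' G'. C1_with_gradient F' G' \<and> (\<forall>x. (\<lambda>n. F n x) \<longlonglongrightarrow> F' x) \<and> (\<forall>x. (\<lambda>n. G n x) \<longlonglongrightarrow> G' x)"
proof -
  obtain l where l: "uniform_limit UNIV F l sequentially"
    using uniform_limit_of_geometric_steps[of F D \<kappa>] assms by auto
  obtain G' where G': "uniform_limit UNIV G G' sequentially"
    using uniform_limit_of_geometric_steps[of G A \<kappa>] assms by auto
  have "\<exists>g. \<forall>x\<in>UNIV. (\<lambda>n. F n x) \<longlonglongrightarrow> g x \<and> (g has_derivative (\<lambda>h. h \<bullet> G' x)) (at x within UNIV)"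
  proof (rule has_derivative_sequence)
    show "(F n has_derivative (\<lambda>h. h \<bullet> G n x)) (at x within UNIV)" for n x
      using C1 by (simp add: C1_with_gradient_def gderiv_def)
    show "(\<lambda>n. F n 0) \<longlonglongrightarrow> l 0"
      by (rule tendsto_uniform_limitI[OF l]) simp
    fix e :: real assume "e > 0"
    with G' have "\<forall>\<^sub>F n in sequentially. \<forall>x\<in>UNIV. dist (G n x) (G' x) < e"
      by (rule uniform_limitD)
    then show "\<forall>\<^sub>F n in sequentially. \<forall>x\<in>UNIV. \<forall>h::'a. norm (h \<bullet> G n x - h \<bullet> G' x) \<le> e * norm h"
    proof (rule eventually_mono, intro ballI allI)
      fix n x and h :: 'a assume "\<forall>x\<in>UNIV. dist (G n x) (G' x) < e"
      then have "norm (G n x - G' x) \<le> e" by (simp add: dist_norm less_imp_le)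
      then have "norm h * norm (G n x - G' x) \<le> norm h * e" by (intro mult_left_mono) auto
      then show "norm (h \<bullet> G n x - h \<bullet> G' x) \<le> e * norm h"
        using Cauchy_Schwarz_ineq2[of h "G n x - G' x"] by (simp add: inner_diff_right mult.commute)
    qed
  qed auto
  then obtain F' where F': "\<And>x. (\<lambda>n. F n x) \<longlonglongrightarrow> F' x" "\<And>x. (F' has_derivative (\<lambda>h. h \<bullet> G' x)) (at x)"
    by auto
  have "continuous_on UNIV G'"
    by (rule uniform_limit_theorem[OF _ G']) (use C1 in \<open>auto simp: C1_with_gradient_def\<close>)
  moreover have "(\<lambda>n. G n x) \<longlonglongrightarrow> G' x" for x
    by (rule tendsto_uniform_limitI[OF G']) simp
  ultimately show ?thesis
    using F' by (auto simp: C1_with_gradient_def gderiv_def)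
qed

text \<open>
  Disjointness of the supports enters the estimates only in this form.
\<close>
lemma norm_sum_at_most_one_nonzero:
  fixes f :: "'i \<Rightarrow> 'b::real_normed_vector"
  assumes "finite I" "0 \<le> c" and le: "\<And>i. i \<in> I \<Longrightarrow> norm (f i) \<le> c"
    and one: "\<And>i j. i \<in> I \<Longrightarrow> j \<in> I \<Longrightarrow> i \<noteq> j \<Longrightarrow> f i = 0 \<or> f j = 0"
  shows "norm (\<Sum>i\<in>I. f i) \<le> c"
proof (cases "\<exists>i\<in>I. f i \<noteq> 0")
  case True
  then obtain i where i: "i \<in> I" "f i \<noteq> 0" by blast
  then have "f j = 0" if "j \<in> I - {i}" for j using one that by blast
  then have "(\<Sum>i\<in>I. f i) = f i"
    using sum.remove[OF \<open>finite I\<close> i(1), of f] by simp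
  then show ?thesis using le i by simp
qed (use assms in simp)

text \<open>
  The function \<open>F\<close> is the limit of the iterates of
  \<open>\<Phi> F = (\<Sum>i. q\<^sub>i (\<eta>\<^sub>i (F \<circ> \<tau>\<^sub>i) + (1 - \<eta>\<^sub>i) \<psi>\<^sub>i))\<close>. A difference of two functions is multiplied by at most
  \<open>\<bar>q\<^sub>i\<bar> \<le> \<theta>\<close>. For gradients the factor is \<open>\<bar>q\<^sub>i\<bar> / \<rho>\<^sub>i \<le> \<theta>\<close>, plus a multiple of the difference of the values
  coming from the gradient of \<open>\<eta>\<^sub>i\<close>; as the values converge geometrically, so do the gradients, at any
  rate \<open>\<kappa> > \<theta>\<close>. On \<open>K\<close> the extra terms cancel because of the assumption \<open>cases\<close>: either \<open>\<eta>\<^sub>i\<close> and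
  \<open>\<psi>\<^sub>i\<close> are extremal, or \<open>F \<circ> \<tau>\<^sub>i\<close> and \<open>\<psi>\<^sub>i\<close> are the same constant. So the gradients on \<open>K\<close> are bounded by
  \<open>\<theta>\<^sup>n\<close> times a constant after \<open>n\<close> steps and vanish in the limit.
\<close>
lemma self_similar_C1_function:
  fixes K a b :: "'a::euclidean_space set" and I :: "'i set"
  assumes fin: "finite I"
    and "compact a" "compact b" "a \<inter> b = {}"
    and \<tau>: "\<And>i f g. i \<in> I \<Longrightarrow> C1_with_gradient f g \<Longrightarrow> C1_with_gradient (\<lambda>x. f (\<tau> i x)) (\<lambda>x. T i (g (\<tau> i x)))"
    and T: "\<And>i. i \<in> I \<Longrightarrow> linear (T i)" "\<And>i v. i \<in> I \<Longrightarrow> norm (T i v) = norm v / \<rho> i"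
    and \<rho>: "\<And>i. i \<in> I \<Longrightarrow> 0 < \<rho> i \<and> \<rho> i \<le> 1"
    and q: "\<And>i. i \<in> I \<Longrightarrow> \<bar>q i\<bar> \<le> \<theta> * \<rho> i" and \<theta>: "0 \<le> \<theta>" "\<theta> < 1"
    and \<eta>: "\<And>i. i \<in> I \<Longrightarrow> C1_with_gradient (\<eta> i) (X i)" "\<And>i x. i \<in> I \<Longrightarrow> 0 \<le> \<eta> i x \<and> \<eta> i x \<le> 1"
        "\<And>i x. i \<in> I \<Longrightarrow> norm (X i x) \<le> B"
    and \<eta>_disj: "\<And>i j x. i \<in> I \<Longrightarrow> j \<in> I \<Longrightarrow> i \<noteq> j \<Longrightarrow> \<eta> i x = 0 \<or> \<eta> j x = 0"
    and \<psi>: "\<And>i. i \<in> I \<Longrightarrow> C1_with_gradient (\<psi> i) (Y i)" "\<And>i x. i \<in> I \<Longrightarrow> \<bar>\<psi> i x\<bar> \<le> 1"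
        "\<And>i x. i \<in> I \<Longrightarrow> norm (Y i x) \<le> B"
    and cases: "\<And>i x. i \<in> I \<Longrightarrow> x \<in> K \<Longrightarrow> (\<eta> i x = 0 \<and> \<bar>\<psi> i x\<bar> = 1) \<or>
          \<tau> i x \<in> K \<and> (\<eta> i x = 1 \<or> \<tau> i x \<in> a \<and> \<psi> i x = -1 \<or> \<tau> i x \<in> b \<and> \<psi> i x = 1)"
    and on_a: "\<And>i x. i \<in> I \<Longrightarrow> x \<in> a \<Longrightarrow> \<eta> i x = 0" "\<And>x. x \<in> a \<Longrightarrow> (\<Sum>i\<in>I. q i * \<psi> i x) = -1"
    and on_b: "\<And>i x. i \<in> I \<Longrightarrow> x \<in> b \<Longrightarrow> \<eta> i x = 0" "\<And>x. x \<in> b \<Longrightarrow> (\<Sum>i\<in>I. q i * \<psi> i x) = 1"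
  shows "\<exists>F G. C1_with_gradient F G \<and> (\<forall>x\<in>a. F x = -1) \<and> (\<forall>x\<in>b. F x = 1) \<and> (\<forall>x\<in>K. G x = 0)"
proof -
  define \<Phi> where "\<Phi> F x = (\<Sum>i\<in>I. q i * (\<eta> i x * F (\<tau> i x) + (1 - \<eta> i x) * \<psi> i x))" for F x
  \<comment> \<open>the gradient of \<open>\<Phi> F\<close> when \<open>G\<close> is the gradient of \<open>F\<close>\<close>
  define \<Gamma> where "\<Gamma> F G x = (\<Sum>i\<in>I. q i *\<^sub>R ((\<eta> i x *\<^sub>R T i (G (\<tau> i x)) + F (\<tau> i x) *\<^sub>R X i x)
      + ((1 - \<eta> i x) *\<^sub>R Y i x + \<psi> i x *\<^sub>R (0 - X i x))))" for F and G :: "'a \<Rightarrow> 'a" and x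
  have step_C1: "C1_with_gradient (\<Phi> F) (\<Gamma> F G)" if "C1_with_gradient F G" for F G
    unfolding \<Phi>_def \<Gamma>_def
    by (intro C1_with_gradient_sum fin C1_with_gradient_cmult C1_with_gradient_add C1_with_gradient_mult
         C1_with_gradient_diff C1_with_gradient_const \<eta> \<psi> \<tau> that)
  have q1: "\<bar>q i\<bar> \<le> \<theta>" "\<bar>q i\<bar> \<le> 1" if "i \<in> I" for i
    using q[OF that] mult_left_le[of "\<rho> i" \<theta>] \<rho>[OF that] \<theta> by auto
  have qT: "norm (q i *\<^sub>R T i v) \<le> \<theta> * norm v" if "i \<in> I" for i v
    using mult_right_mono[OF q[OF that], of "norm v / \<rho> i"] \<rho>[OF that] T(2)[OF that] by simp
  have X0: "X i x = 0" if "i \<in> I" "\<eta> i x = 0 \<or> \<eta> i x = 1" for i x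
    using that \<eta>(2) by (intro gradient_at_global_extremum[OF \<eta>(1)]) auto
  have Y0: "Y i x = 0" if "i \<in> I" "\<bar>\<psi> i x\<bar> = 1" for i x
  proof (intro gradient_at_global_extremum[OF \<psi>(1)])
    have "-1 \<le> \<psi> i y \<and> \<psi> i y \<le> 1" for y using \<psi>(2)[OF that(1), of y] by auto
    moreover have "\<psi> i x = 1 \<or> \<psi> i x = -1" using that by auto
    ultimately show "(\<forall>y. \<psi> i y \<le> \<psi> i x) \<or> (\<forall>y. \<psi> i x \<le> \<psi> i y)" by auto
  qed (use that in simp)
  have \<Phi>_contr: "\<bar>\<Phi> F x - \<Phi> F' x\<bar> \<le> \<theta> * d" if d: "\<And>x. \<bar>F x - F' x\<bar> \<le> d" for F F' d x
  proof -
    have d0: "0 \<le> d" using d[of x] by simp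
    have "\<Phi> F x - \<Phi> F' x = (\<Sum>i\<in>I. q i * (\<eta> i x * (F (\<tau> i x) - F' (\<tau> i x))))"
      unfolding \<Phi>_def sum_subtractf[symmetric] by (intro sum.cong) (auto simp: algebra_simps)
    also have "norm \<dots> \<le> \<theta> * d"
    proof (rule norm_sum_at_most_one_nonzero[OF fin])
      fix i assume i: "i \<in> I"
      have "\<bar>q i\<bar> * (\<bar>\<eta> i x\<bar> * \<bar>F (\<tau> i x) - F' (\<tau> i x)\<bar>) \<le> \<theta> * (1 * d)"
        using q1[OF i] \<eta>(2)[OF i] d d0 \<theta> by (intro mult_mono) auto
      then show "norm (q i * (\<eta> i x * (F (\<tau> i x) - F' (\<tau> i x)))) \<le> \<theta> * d"
        by (simp add: abs_mult)
    qed (use \<theta> d0 \<eta>_disj in auto)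
    finally show ?thesis by simp
  qed
  have \<Gamma>_contr: "norm (\<Gamma> F G x - \<Gamma> F' G' x) \<le> B * d + \<theta> * e"
    if d: "\<And>x. \<bar>F x - F' x\<bar> \<le> d" and e: "\<And>x. norm (G x - G' x) \<le> e" and B: "0 \<le> B" for F F' d e G G' x
  proof -
    have d0: "0 \<le> d" using d[of x] by simp
    have e0: "0 \<le> e" using norm_ge_zero e[of x] by (rule order_trans)
    let ?t = "\<lambda>i. q i *\<^sub>R (\<eta> i x *\<^sub>R T i (G (\<tau> i x) - G' (\<tau> i x)) + (F (\<tau> i x) - F' (\<tau> i x)) *\<^sub>R X i x)"
    have "\<Gamma> F G x - \<Gamma> F' G' x = (\<Sum>i\<in>I. ?t i)"
      unfolding \<Gamma>_def sum_subtractf[symmetric]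
      by (intro sum.cong) (auto simp: algebra_simps linear_diff[OF T(1)])
    also have "norm \<dots> \<le> B * d + \<theta> * e"
    proof (rule norm_sum_at_most_one_nonzero[OF fin])
      fix i assume i: "i \<in> I"
      have "norm (\<eta> i x *\<^sub>R (q i *\<^sub>R T i (G (\<tau> i x) - G' (\<tau> i x)))) \<le> 1 * (\<theta> * norm (G (\<tau> i x) - G' (\<tau> i x)))"
        unfolding norm_scaleR[of "\<eta> i x"] using qT[OF i] \<eta>(2)[OF i] \<theta> by (intro mult_mono) auto
      also have "\<dots> \<le> \<theta> * e" using e \<theta> by (simp add: mult_left_mono)
      finally have 1: "norm (\<eta> i x *\<^sub>R (q i *\<^sub>R T i (G (\<tau> i x) - G' (\<tau> i x)))) \<le> \<theta> * e" .
      have "\<bar>q i\<bar> * (\<bar>F (\<tau> i x) - F' (\<tau> i x)\<bar> * norm (X i x)) \<le> 1 * (d * B)"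
        using q1[OF i] d d0 \<eta>(3)[OF i] by (intro mult_mono) auto
      then have 2: "norm (q i *\<^sub>R ((F (\<tau> i x) - F' (\<tau> i x)) *\<^sub>R X i x)) \<le> B * d"
        by (simp add: abs_mult mult_ac)
      have "?t i = \<eta> i x *\<^sub>R (q i *\<^sub>R T i (G (\<tau> i x) - G' (\<tau> i x))) + q i *\<^sub>R ((F (\<tau> i x) - F' (\<tau> i x)) *\<^sub>R X i x)"
        by (simp add: algebra_simps)
      then show "norm (?t i) \<le> B * d + \<theta> * e"
        using norm_triangle_mono[OF 1 2] by simp
    next
      fix i j assume ij: "i \<in> I" "j \<in> I" "i \<noteq> j"
      have "?t i = 0" if "i \<in> I" "\<eta> i x = 0" for i using X0 that by simp
      then show "?t i = 0 \<or> ?t j = 0" using \<eta>_disj[OF ij] ij by blast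
    qed (use B d0 e0 \<theta> in auto)
    finally show ?thesis .
  qed
  have \<Phi>_ends: "(\<forall>x\<in>a. \<Phi> F x = -1) \<and> (\<forall>x\<in>b. \<Phi> F x = 1)" for F
    unfolding \<Phi>_def using on_a on_b by simp
  have \<Gamma>_K: "norm (\<Gamma> F G x) \<le> \<theta> * M"
    if F: "\<forall>x\<in>a. F x = -1" "\<forall>x\<in>b. F x = 1" and M: "\<And>x. x \<in> K \<Longrightarrow> norm (G x) \<le> M" and x: "x \<in> K" for F G M x
  proof -
    have M0: "0 \<le> M" using norm_ge_zero M[OF x] by (rule order_trans)
    let ?t = "\<lambda>i. q i *\<^sub>R ((\<eta> i x *\<^sub>R T i (G (\<tau> i x)) + F (\<tau> i x) *\<^sub>R X i x)
      + ((1 - \<eta> i x) *\<^sub>R Y i x + \<psi> i x *\<^sub>R (0 - X i x)))"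
    \<comment> \<open>on \<open>K\<close> all terms with a gradient of \<open>\<eta> i\<close> or \<open>\<psi> i\<close> vanish or cancel\<close>
    have t: "?t i = 0 \<or> \<tau> i x \<in> K \<and> ?t i = \<eta> i x *\<^sub>R (q i *\<^sub>R T i (G (\<tau> i x)))" if i: "i \<in> I" for i
      using cases[OF i x] X0[OF i, of x] Y0[OF i, of x] F by (auto simp: algebra_simps)
    show ?thesis unfolding \<Gamma>_def
    proof (rule norm_sum_at_most_one_nonzero[OF fin])
      fix i assume i: "i \<in> I"
      have "norm (\<eta> i x *\<^sub>R (q i *\<^sub>R T i (G (\<tau> i x)))) \<le> \<theta> * M" if "\<tau> i x \<in> K"
      proof -
        have "norm (\<eta> i x *\<^sub>R (q i *\<^sub>R T i (G (\<tau> i x)))) \<le> 1 * (\<theta> * norm (G (\<tau> i x)))"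
          unfolding norm_scaleR[of "\<eta> i x"] using qT[OF i] \<eta>(2)[OF i] \<theta> by (intro mult_mono) auto
        also have "\<dots> \<le> \<theta> * M" using M[OF that] \<theta> by (simp add: mult_left_mono)
        finally show ?thesis .
      qed
      then show "norm (?t i) \<le> \<theta> * M" using t[OF i] M0 \<theta> by fastforce
    next
      fix i j assume ij: "i \<in> I" "j \<in> I" "i \<noteq> j"
      then show "?t i = 0 \<or> ?t j = 0" using \<eta>_disj[OF ij, of x] t[of i] t[of j] by (metis scaleR_zero_left)
    qed (use M0 \<theta> in auto)
  qed
  obtain F0 G0 B0 where F0: "C1_with_gradient F0 G0" "range F0 \<subseteq> {-1..1}" "\<forall>x\<in>a. F0 x = -1" "\<forall>x\<in>b. F0 x = 1"
      "\<And>x. norm (G0 x) \<le> B0"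
    using C1_separation[OF \<open>compact a\<close> \<open>compact b\<close> \<open>a \<inter> b = {}\<close>] by metis
  have F0': "\<bar>F0 x\<bar> \<le> 1" for x using F0(2) by (auto simp: image_subset_iff abs_le_iff)
  define S where "S n = ((\<lambda>(F, G). (\<Phi> F, \<Gamma> F G)) ^^ n) (F0, G0)" for n
  define Fs where "Fs n = fst (S n)" for n
  define Gs where "Gs n = snd (S n)" for n
  have Fs0: "Fs 0 = F0" "Gs 0 = G0" and Fs_Suc: "Fs (Suc n) = \<Phi> (Fs n)" and Gs_Suc: "Gs (Suc n) = \<Gamma> (Fs n) (Gs n)" for n
    by (auto simp: Fs_def Gs_def S_def split: prod.splits)
  have C1: "C1_with_gradient (Fs n) (Gs n)" for n
    by (induction n) (auto simp: Fs0 Fs_Suc Gs_Suc F0 step_C1)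
  have ends: "(\<forall>x\<in>a. Fs n x = -1) \<and> (\<forall>x\<in>b. Fs n x = 1)" for n
    by (cases n) (auto simp: Fs0 Fs_Suc F0 \<Phi>_ends)
  have on_K: "norm (Gs n x) \<le> \<theta> ^ n * B0" if "x \<in> K" for n x
    using that
  proof (induction n arbitrary: x)
    case (Suc n)
    then show ?case using \<Gamma>_K[of "Fs n" "Gs n" "\<theta> ^ n * B0" x] ends[of n] by (simp add: Gs_Suc mult.assoc)
  qed (simp add: Fs0 F0)
  define B' where "B' = max 0 B"
  have B': "0 \<le> B'" "B \<le> B'" by (auto simp: B'_def)
  define D where "D = (\<Sum>i\<in>I. 2) + (1::real)"
  define E where "E = (\<Sum>i\<in>I. B0 / \<rho> i + B' + (B' + B')) + B0"
  have D: "\<bar>\<Phi> F0 x - F0 x\<bar> \<le> D" for x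
  proof -
    have "\<bar>\<Phi> F0 x\<bar> \<le> (\<Sum>i\<in>I. \<bar>q i * (\<eta> i x * F0 (\<tau> i x) + (1 - \<eta> i x) * \<psi> i x)\<bar>)"
      unfolding \<Phi>_def by (rule sum_abs)
    also have "\<dots> \<le> (\<Sum>i\<in>I. 2)"
    proof (rule sum_mono)
      fix i assume i: "i \<in> I"
      have "\<bar>\<eta> i x * F0 (\<tau> i x)\<bar> \<le> 1" "\<bar>(1 - \<eta> i x) * \<psi> i x\<bar> \<le> 1"
        unfolding abs_mult using \<eta>(2)[OF i, of x] \<psi>(2)[OF i] F0' by (auto intro!: mult_le_one)
      then have "\<bar>\<eta> i x * F0 (\<tau> i x) + (1 - \<eta> i x) * \<psi> i x\<bar> \<le> 2" by linarith
      then show "\<bar>q i * (\<eta> i x * F0 (\<tau> i x) + (1 - \<eta> i x) * \<psi> i x)\<bar> \<le> 2"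
        using mult_mono[OF q1(2)[OF i]] unfolding abs_mult by fastforce
    qed
    finally show ?thesis using F0'[of x] unfolding D_def by linarith
  qed
  have E: "norm (\<Gamma> F0 G0 x - G0 x) \<le> E" for x
  proof -
    have "norm (\<Gamma> F0 G0 x) \<le> (\<Sum>i\<in>I. B0 / \<rho> i + B' + (B' + B'))"
      unfolding \<Gamma>_def
    proof (rule sum_norm_le)
      fix i assume i: "i \<in> I"
      have "norm (\<eta> i x *\<^sub>R T i (G0 (\<tau> i x))) \<le> 1 * (B0 / \<rho> i)"
        unfolding norm_scaleR T(2)[OF i] using \<eta>(2)[OF i, of x] F0(5) \<rho>[OF i] by (intro mult_mono divide_right_mono) auto
      moreover have "norm (F0 (\<tau> i x) *\<^sub>R X i x) \<le> 1 * B'"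
        unfolding norm_scaleR using F0' order_trans[OF \<eta>(3)[OF i] B'(2)] by (intro mult_mono) auto
      moreover have "norm ((1 - \<eta> i x) *\<^sub>R Y i x) \<le> 1 * B'"
        unfolding norm_scaleR using \<eta>(2)[OF i, of x] order_trans[OF \<psi>(3)[OF i] B'(2)] by (intro mult_mono) auto
      moreover have "norm (\<psi> i x *\<^sub>R (0 - X i x)) \<le> 1 * B'"
        unfolding norm_scaleR using \<psi>(2)[OF i] order_trans[OF \<eta>(3)[OF i] B'(2)] by (intro mult_mono) auto
      ultimately have *: "norm ((\<eta> i x *\<^sub>R T i (G0 (\<tau> i x)) + F0 (\<tau> i x) *\<^sub>R X i x)
         + ((1 - \<eta> i x) *\<^sub>R Y i x + \<psi> i x *\<^sub>R (0 - X i x))) \<le> B0 / \<rho> i + B' + (B' + B')"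
        by (intro norm_triangle_mono) auto
      have "norm (q i *\<^sub>R v) \<le> norm v" for v :: 'a
        using q1(2)[OF i] by (simp add: mult_left_le_one_le)
      then show "norm (q i *\<^sub>R ((\<eta> i x *\<^sub>R T i (G0 (\<tau> i x)) + F0 (\<tau> i x) *\<^sub>R X i x)
         + ((1 - \<eta> i x) *\<^sub>R Y i x + \<psi> i x *\<^sub>R (0 - X i x)))) \<le> B0 / \<rho> i + B' + (B' + B')"
        using * order_trans by blast
    qed
    then show ?thesis
      unfolding E_def using norm_triangle_ineq4[of "\<Gamma> F0 G0 x" "G0 x"] F0(5)[of x] by linarith
  qed
  have D0: "0 \<le> D" using D[of 0] by simp
  define \<kappa> where "\<kappa> = (1 + \<theta>) / 2"
  have \<kappa>: "0 \<le> \<kappa>" "\<kappa> < 1" "\<theta> < \<kappa>" using \<theta> by (auto simp: \<kappa>_def)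
  \<comment> \<open>large enough to absorb the contribution of the values at every step\<close>
  define A where "A = max E (B' * D / (\<kappa> - \<theta>))"
  have "B' * D / (\<kappa> - \<theta>) \<le> A" by (simp add: A_def)
  then have A: "B' * D + \<theta> * A \<le> \<kappa> * A" using \<kappa> by (simp add: divide_le_eq algebra_simps)
  have D_n: "\<bar>Fs (Suc n) x - Fs n x\<bar> \<le> D * \<kappa> ^ n" for n x
  proof (induction n arbitrary: x)
    case (Suc n)
    have "\<bar>Fs (Suc (Suc n)) x - Fs (Suc n) x\<bar> \<le> \<theta> * (D * \<kappa> ^ n)"
      using \<Phi>_contr[of "Fs (Suc n)" "Fs n"] Suc.IH by (simp add: Fs_Suc)
    also have "\<dots> \<le> \<kappa> * (D * \<kappa> ^ n)" using \<kappa> D0 by (intro mult_right_mono) auto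
    finally show ?case by (simp add: mult_ac)
  qed (simp add: Fs0 Fs_Suc D)
  have E_n: "norm (Gs (Suc n) x - Gs n x) \<le> A * \<kappa> ^ n" for n x
  proof (induction n arbitrary: x)
    case 0
    then show ?case using E[of x] by (simp add: Fs0 Gs_Suc A_def)
  next
    case (Suc n)
    have "B * (D * \<kappa> ^ n) \<le> B' * (D * \<kappa> ^ n)" using B' D0 \<kappa> by (intro mult_right_mono) auto
    moreover have "norm (Gs (Suc (Suc n)) x - Gs (Suc n) x) \<le> B * (D * \<kappa> ^ n) + \<theta> * (A * \<kappa> ^ n)" if "0 \<le> B"
      using \<Gamma>_contr[of "Fs (Suc n)" "Fs n" "D * \<kappa> ^ n" "Gs (Suc n)" "Gs n" "A * \<kappa> ^ n" x] that Suc.IH D_n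
      by (simp add: Gs_Suc)
    moreover have "norm (Gs (Suc (Suc n)) x - Gs (Suc n) x) = 0" if "\<not> 0 \<le> B"
    proof -
      have "I = {}" using that \<eta>(3)[of _ 0] norm_ge_zero by (metis all_not_in_conv order_trans)
      then show ?thesis by (simp add: Gs_Suc \<Gamma>_def)
    qed
    moreover have "0 \<le> A * \<kappa> ^ n" using Suc.IH norm_ge_zero by (meson order_trans)
    moreover have "(B' * D + \<theta> * A) * \<kappa> ^ n \<le> (\<kappa> * A) * \<kappa> ^ n" using A \<kappa> by (intro mult_right_mono) auto
    moreover have "0 \<le> \<kappa> * (A * \<kappa> ^ n)" using calculation(4) \<kappa> by simp
    ultimately show ?case by (cases "0 \<le> B") (auto simp: algebra_simps)
  qed
  obtain F G where FG: "C1_with_gradient F G" "\<And>x. (\<lambda>n. Fs n x) \<longlonglongrightarrow> F x" "\<And>x. (\<lambda>n. Gs n x) \<longlonglongrightarrow> G x"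
    using C1_limit_of_geometric_steps[OF C1 D_n E_n \<kappa>(1,2)] by metis
  have "F x = -1" if "x \<in> a" for x
    using FG(2)[of x] ends that by (simp add: LIMSEQ_const_iff)
  moreover have "F x = 1" if "x \<in> b" for x
    using FG(2)[of x] ends that by (simp add: LIMSEQ_const_iff)
  moreover have "G x = 0" if "x \<in> K" for x
  proof -
    have "(\<lambda>n. \<theta> ^ n * B0) \<longlonglongrightarrow> 0 * B0"
      using \<theta> by (intro tendsto_mult LIMSEQ_power_zero tendsto_const) auto
    then have "(\<lambda>n. Gs n x) \<longlonglongrightarrow> 0"
      by (intro Lim_null_comparison[OF always_eventually, of "\<lambda>n. Gs n x"]) (use on_K that in auto)
    then show ?thesis using FG(3) LIMSEQ_unique by blast
  qed
  ultimately show ?thesis using FG(1) by blast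
qed

section \<open>Charts of arcs\<close>

text \<open>
  Read through the chart \<open>h\<close>, the map \<open>k\<close> is a continuous injection of an interval.
\<close>
lemma injective_on_arc_monotone:
  fixes h k :: "'a::t2_space \<Rightarrow> real"
  assumes "compact K" and h: "continuous_on K h" "inj_on h K" "h ` K = {\<alpha>..\<beta>}"
    and k: "continuous_on K k" "inj_on k K"
  shows "(\<forall>x\<in>K. \<forall>y\<in>K. h x < h y \<longrightarrow> k x < k y) \<or> (\<forall>x\<in>K. \<forall>y\<in>K. h x < h y \<longrightarrow> k y < k x)"
proof -
  let ?u = "k \<circ> inv_into K h"
  have inv: "inv_into K h ` {\<alpha>..\<beta>} = K"
    using h by (metis image_inv_into_cancel inv_into_image_cancel order_refl)
  have "continuous_on {\<alpha>..\<beta>} (inv_into K h)"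
    using continuous_on_inv[OF h(1) \<open>compact K\<close>, of "inv_into K h"] h by simp
  then have "continuous_on {\<alpha>..\<beta>} ?u"
    using k(1) inv by (intro continuous_on_compose) simp_all
  moreover have "inj_on ?u {\<alpha>..\<beta>}"
    using h(3) inv k(2) by (intro comp_inj_on inj_on_inv_into) auto
  ultimately have "strict_mono_on {\<alpha>..\<beta>} ?u \<or> strict_antimono_on {\<alpha>..\<beta>} ?u"
    using injective_eq_monotone_map[of "{\<alpha>..\<beta>}" ?u] by (simp add: is_interval_cc)
  moreover have "?u (h x) = k x" "h x \<in> {\<alpha>..\<beta>}" if "x \<in> K" for x
    using h that by auto
  ultimately show ?thesis
    unfolding monotone_on_def by metis
qed

lemma arc_image_in_chart:
  fixes h :: "'a::t2_space \<Rightarrow> real"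
  assumes "arc g" "path_image g \<subseteq> K" "continuous_on K h" "inj_on h K"
  shows "h ` path_image g = closed_segment (h (pathstart g)) (h (pathfinish g))"
    and "h (pathstart g) \<noteq> h (pathfinish g)"
proof -
  have cont: "continuous_on {0..1} (\<lambda>t. h (g t))"
    using assms unfolding arc_def path_def path_image_def
    by (intro continuous_on_compose2[OF assms(3)]) auto
  have inj: "inj_on (\<lambda>t. h (g t)) {0..1}"
    using assms unfolding arc_def path_image_def inj_on_def by blast
  show ne: "h (pathstart g) \<noteq> h (pathfinish g)"
    using inj_onD[OF inj, of 0 1] by (auto simp: pathstart_def pathfinish_def)
  have "strict_mono_on {0..1} (\<lambda>t. h (g t)) \<or> strict_antimono_on {0..1} (\<lambda>t. h (g t))"
    using injective_eq_monotone_map[of "{0..1}", OF _ cont] inj by (simp add: is_interval_cc)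
  then have "h (g t) \<in> closed_segment (h (g 0)) (h (g 1))" if "t \<in> {0..1}" for t
  proof
    assume "strict_mono_on {0..1} (\<lambda>t. h (g t))"
    then have "mono_on {0..1} (\<lambda>t. h (g t))" by (rule strict_mono_on_imp_mono_on)
    then show ?thesis using that by (auto simp: closed_segment_eq_real_ivl mono_on_def)
  next
    assume "strict_antimono_on {0..1} (\<lambda>t. h (g t))"
    then have "antimono_on {0..1} (\<lambda>t. h (g t))" by (simp add: strict_antimono_iff_antimono)
    then have "h (g 1) \<le> h (g t)" "h (g t) \<le> h (g 0)" using that by (auto simp: monotone_on_def)
    then show ?thesis by (auto simp: closed_segment_eq_real_ivl)
  qed
  moreover have "closed_segment (h (g 0)) (h (g 1)) \<subseteq> (\<lambda>t. h (g t)) ` {0..1}"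
  proof (rule closed_segment_subset)
    show "convex ((\<lambda>t. h (g t)) ` {0..1})"
      using connected_continuous_image[OF cont] by (simp add: is_interval_convex_1[symmetric] is_interval_connected_1)
  qed auto
  ultimately show "h ` path_image g = closed_segment (h (pathstart g)) (h (pathfinish g))"
    by (auto simp: path_image_def pathstart_def pathfinish_def)
qed

text \<open>
  Every piece is a nondegenerate interval with the prescribed end points in any chart of the arc. Two
  consecutive pieces share only one point, so the next interval cannot turn back over the previous
  one: the breakpoints \<open>t l\<close> move steadily in one direction, which a reflection makes the positive one.
  In particular, pieces that are not consecutive are disjoint.
\<close>
lemma decomposition_chart:
  fixes K :: "'a::t2_space set"
  assumes dec: "arc_decomposition K \<gamma> n" and "n \<ge> 1"
  shows "\<exists>(h :: 'a \<Rightarrow> real) t. continuous_on K h \<and> inj_on h K \<and>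
     (\<forall>l\<in>{1..n}. t (l - 1) < t l \<and> \<gamma> l \<subseteq> K \<and> h ` \<gamma> l = {t (l - 1)..t l})"
proof -
  obtain p where p: "\<And>l. l \<in> {1..n} \<Longrightarrow> \<gamma> l \<subseteq> K \<and> arc_from_to (\<gamma> l) (p (l - 1)) (p l)"
      and meet: "\<And>l. l \<in> {1..<n} \<Longrightarrow> \<gamma> l \<inter> \<gamma> (Suc l) = {p l}" and "is_arc K"
    using dec unfolding arc_decomposition_def by blast
  obtain h0 :: "'a \<Rightarrow> real" where h0: "continuous_on K h0" "inj_on h0 K"
    using \<open>is_arc K\<close> homeomorphic_sym unfolding is_arc_def homeomorphic_def homeomorphism_def
    by (metis inj_on_inverseI)
  define h where "h x = (if h0 (p 0) < h0 (p 1) then h0 x else - h0 x)" for x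
  have h: "continuous_on K h" "inj_on h K"
    using h0 by (cases "h0 (p 0) < h0 (p 1)"; simp add: h_def[abs_def] inj_on_def continuous_on_minus)+
  have seg: "h ` \<gamma> l = closed_segment (h (p (l - 1))) (h (p l)) \<and> h (p (l - 1)) \<noteq> h (p l)" if l: "l \<in> {1..n}" for l
  proof -
    obtain g where "arc g" "path_image g = \<gamma> l" "pathstart g = p (l - 1)" "pathfinish g = p l"
      using p[OF l] unfolding arc_from_to_def by blast
    then show ?thesis using arc_image_in_chart[OF \<open>arc g\<close> _ h] p[OF l] by simp
  qed
  have less: "h (p (l - 1)) < h (p l)" if "l \<ge> 1" "l \<le> n" for l
    using that
  proof (induction l rule: dec_induct)
    case base
    have "h0 (p 0) \<noteq> h0 (p 1)" using seg[of 1] \<open>n \<ge> 1\<close> by (auto simp: h_def split: if_splits)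
    then show ?case by (simp add: h_def)
  next
    case (step l)
    then have l: "l \<in> {1..n}" "Suc l \<in> {1..n}" "l \<in> {1..<n}" by auto
    have IH: "h (p (l - 1)) < h (p l)" using step by simp
    show ?case
    proof (rule ccontr)
      assume "\<not> ?thesis"
      then have gt: "h (p (Suc l)) < h (p l)" using seg[OF l(2)] by simp
      \<comment> \<open>if the interval of \<open>\<gamma> (Suc l)\<close> turned back, the two pieces would share this point besides \<open>p l\<close>\<close>
      define v where "v = max (h (p (l - 1))) (h (p (Suc l)))"
      have "v \<in> h ` \<gamma> l" "v \<in> h ` \<gamma> (Suc l)"
        using seg[OF l(1)] seg[OF l(2)] IH gt by (auto simp: v_def closed_segment_eq_real_ivl)
      then have "v \<in> h ` (\<gamma> l \<inter> \<gamma> (Suc l))"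
        using inj_on_image_Int[OF h(2), of "\<gamma> l" "\<gamma> (Suc l)"] p l by blast
      then show False using meet[OF l(3)] IH gt by (auto simp: v_def)
    qed
  qed
  show ?thesis
  proof (intro exI[of _ h] exI[of _ "\<lambda>l. h (p l)"] conjI ballI h)
    fix l assume l: "l \<in> {1..n}"
    show "h (p (l - 1)) < h (p l)" using less l by simp
    show "\<gamma> l \<subseteq> K" using p l by blast
    show "h ` \<gamma> l = {h (p (l - 1))..h (p l)}"
      using seg[OF l] less l by (auto simp: closed_segment_eq_real_ivl)
  qed
qed

lemma compact_level_set:
  fixes h :: "'a::t2_space \<Rightarrow> real"
  assumes "compact K" "continuous_on K h" "closed V"
  shows "compact {x \<in> K. h x \<in> V}"
proof -
  have "closed (K \<inter> h -` V)"
    by (intro continuous_closed_preimage assms compact_imp_closed[OF assms(1)])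
  then have "compact (K \<inter> (K \<inter> h -` V))" by (rule compact_Int_closed[OF assms(1)])
  moreover have "K \<inter> (K \<inter> h -` V) = {x \<in> K. h x \<in> V}" by auto
  ultimately show ?thesis by simp
qed

section \<open>Arcs with similar subarcs\<close>

text \<open>
  The step has to lie within the copy \<open>\<phi>(K)\<close>, between the images of the two end pieces \<open>h \<le> s\<close> and
  \<open>t \<le> h\<close>, and it takes the value \<open>-1\<close> on the image of the first and \<open>1\<close> on the image of the last of
  them. The sign \<open>\<sigma>\<close> says whether \<open>\<phi>\<close> preserves or reverses the order of the arc; a reversed copy
  starts with the image of the last piece, and then the step descends along \<open>K\<close>.
\<close>
lemma oriented_step_function:
  fixes h :: "'a::euclidean_space \<Rightarrow> real"
  assumes K: "compact K" and h: "continuous_on K h" "inj_on h K" "h ` K = {\<alpha>..\<beta>}"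
    and st: "\<alpha> < s" "s < t" "t < \<beta>"
    and \<phi>: "continuous_on K \<phi>" "inj_on \<phi> K" "\<phi> ` K \<subseteq> K" "h ` \<phi> ` K = {\<alpha>'..\<beta>'}"
  shows "\<exists>\<psi> Y \<sigma> B. C1_with_gradient \<psi> Y \<and> (\<forall>x. \<bar>\<psi> x\<bar> \<le> 1) \<and> (\<forall>x. norm (Y x) \<le> B) \<and> \<bar>\<sigma>::real\<bar> = 1 \<and>
    (\<forall>x\<in>K. (h x \<le> \<alpha>' \<longrightarrow> \<psi> x = - \<sigma>) \<and> (\<beta>' \<le> h x \<longrightarrow> \<psi> x = \<sigma>) \<and>
       (h x \<le> s \<longrightarrow> \<psi> (\<phi> x) = -1) \<and> (t \<le> h x \<longrightarrow> \<psi> (\<phi> x) = 1) \<and>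
       (s \<le> h x \<and> h x \<le> t \<longrightarrow> \<alpha>' < h (\<phi> x) \<and> h (\<phi> x) < \<beta>'))"
proof -
  define k where "k x = h (\<phi> x)" for x
  have k: "continuous_on K k" "inj_on k K"
    using h \<phi> continuous_on_compose2[OF h(1) \<phi>(1)] comp_inj_on[OF \<phi>(2) inj_on_subset[OF h(2)]]
    unfolding k_def comp_def by blast+
  have kK: "k x \<in> {\<alpha>'..\<beta>'}" if "x \<in> K" for x
    using \<phi>(4) that unfolding k_def by blast
  have "{\<alpha>, s, t, \<beta>} \<subseteq> h ` K" using h(3) st by auto
  then obtain xa xs xt xb where pts: "xa \<in> K" "xs \<in> K" "xt \<in> K" "xb \<in> K"
      "h xa = \<alpha>" "h xs = s" "h xt = t" "h xb = \<beta>"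
    by auto
  have sep: "\<exists>f g B. C1_with_gradient f g \<and> range f \<subseteq> {-1..1} \<and> (\<forall>x\<in>K. h x \<le> c \<longrightarrow> f x = - 1) \<and> (\<forall>x\<in>K. d \<le> h x \<longrightarrow> f x = 1)
           \<and> (\<forall>x. norm (g x) \<le> B)" if "c < d" for c d
  proof -
    have "compact {x \<in> K. h x \<in> {..c}}" "compact {x \<in> K. h x \<in> {d..}}"
      by (intro compact_level_set K h closed_atMost closed_atLeast)+
    moreover have "{x \<in> K. h x \<in> {..c}} \<inter> {x \<in> K. h x \<in> {d..}} = {}" using that by auto
    ultimately have "\<exists>f g B. C1_with_gradient f g \<and> range f \<subseteq> {-1..1} \<and> (\<forall>x\<in>{x \<in> K. h x \<in> {..c}}. f x = -1)
        \<and> (\<forall>x\<in>{x \<in> K. h x \<in> {d..}}. f x = 1) \<and> (\<forall>x. norm (g x) \<le> B)"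
      by (rule C1_separation)
    then obtain f g B where "C1_with_gradient f g" "range f \<subseteq> {-1..1}" "\<forall>x\<in>{x \<in> K. h x \<in> {..c}}. f x = -1"
        "\<forall>x\<in>{x \<in> K. h x \<in> {d..}}. f x = 1" "\<forall>x. norm (g x) \<le> B"
      by (elim exE conjE) (rule that)
    then show ?thesis by (intro exI[of _ f] exI[of _ g] exI[of _ B]) auto
  qed
  have weak: "k x \<le> k y" if "\<forall>x\<in>K. \<forall>y\<in>K. h x < h y \<longrightarrow> k x < k y" "x \<in> K" "y \<in> K" "h x \<le> h y" for x y and k :: "'a \<Rightarrow> real"
  proof (cases "h x = h y")
    case True
    then show ?thesis using inj_onD[OF h(2) True] that(2,3) by simp
  next
    case False
    then have "h x < h y" using that(4) by simp
    then show ?thesis using that(1-3) less_imp_le by blast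
  qed
  consider "\<forall>x\<in>K. \<forall>y\<in>K. h x < h y \<longrightarrow> k x < k y" | "\<forall>x\<in>K. \<forall>y\<in>K. h x < h y \<longrightarrow> k y < k x"
    using injective_on_arc_monotone[OF K h k] by blast
  then show ?thesis
  proof cases
    case 1
    have "k xs < k xt" using 1 pts st by simp
    then obtain f g B where f: "C1_with_gradient f g" "range f \<subseteq> {-1..1}" "\<forall>x\<in>K. h x \<le> k xs \<longrightarrow> f x = - 1"
        "\<forall>x\<in>K. k xt \<le> h x \<longrightarrow> f x = 1" "\<forall>x. norm (g x) \<le> B"
      using sep by blast
    have le: "k x \<le> k y" if "x \<in> K" "y \<in> K" "h x \<le> h y" for x y using weak[OF 1] that by blast
    have "\<alpha>' < k x \<and> k x < \<beta>'" if "x \<in> K" "s \<le> h x" "h x \<le> t" for x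
      using 1[rule_format, of xa x] 1[rule_format, of x xb] that pts st kK[of xa] kK[of xb] by auto
    moreover have "k x \<le> k xs" if "x \<in> K" "h x \<le> s" for x using le[of x xs] that pts by auto
    moreover have "k xt \<le> k x" if "x \<in> K" "t \<le> h x" for x using le[of xt x] that pts by auto
    moreover have "\<phi> x \<in> K" if "x \<in> K" for x using that \<phi>(3) by auto
    moreover have "\<alpha>' \<le> k xs" "k xt \<le> \<beta>'" using kK pts by auto
    moreover have "-1 \<le> f x \<and> f x \<le> 1" for x using f(2) by (auto simp: image_subset_iff)
    ultimately show ?thesis
      using f(1,3,4,5)
      by (intro exI[of _ f] exI[of _ g] exI[of _ 1] exI[of _ B] conjI ballI allI impI)
        (auto simp: k_def[symmetric] abs_le_iff minus_le_iff)
  next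
    case 2
    have "k xt < k xs" using 2 pts st by simp
    then obtain f g B where f: "C1_with_gradient f g" "range f \<subseteq> {-1..1}" "\<forall>x\<in>K. h x \<le> k xt \<longrightarrow> f x = - 1"
        "\<forall>x\<in>K. k xs \<le> h x \<longrightarrow> f x = 1" "\<forall>x. norm (g x) \<le> B"
      using sep by blast
    have le: "k y \<le> k x" if "x \<in> K" "y \<in> K" "h x \<le> h y" for x y
      using weak[of "\<lambda>x. - k x" x y] 2 that by simp
    have "\<alpha>' < k x \<and> k x < \<beta>'" if "x \<in> K" "s \<le> h x" "h x \<le> t" for x
      using 2[rule_format, of xa x] 2[rule_format, of x xb] that pts st kK[of xa] kK[of xb] by auto
    moreover have "k xs \<le> k x" if "x \<in> K" "h x \<le> s" for x using le[of x xs] that pts by auto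
    moreover have "k x \<le> k xt" if "x \<in> K" "t \<le> h x" for x using le[of xt x] that pts by auto
    moreover have "\<phi> x \<in> K" if "x \<in> K" for x using that \<phi>(3) by auto
    moreover have "\<alpha>' \<le> k xt" "k xs \<le> \<beta>'" using kK pts by auto
    moreover have "-1 \<le> f x \<and> f x \<le> 1" for x using f(2) by (auto simp: image_subset_iff)
    ultimately show ?thesis
      using f(3,4,5) C1_with_gradient_cmult[OF f(1), of "-1"]
      by (intro exI[of _ "\<lambda>x. -1 * f x"] exI[of _ "\<lambda>x. -1 *\<^sub>R g x"] exI[of _ "-1"] exI[of _ B] conjI ballI allI impI)
        (auto simp: k_def[symmetric] abs_le_iff minus_le_iff)
  qed
qed

text \<open>
  With the weights \<open>q\<^sub>i = \<sigma>\<^sub>i \<rho>\<^sub>i / \<Sum> \<rho>\<^sub>j\<close> the boundary values reproduce themselves: on the first piece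
  \<open>h \<le> s\<close> every \<open>\<psi>\<^sub>i\<close> is \<open>- \<sigma>\<^sub>i\<close>, so \<open>\<Sum> q\<^sub>i \<psi>\<^sub>i = -1\<close>, and the sum is \<open>1\<close> on the last
  piece \<open>t \<le> h\<close>. The cutoffs are available because the copies overlap at most in end points, and the
  middle part of a copy avoids its end points.
\<close>
lemma whitney_set_of_self_similar_arc:
  fixes K :: "'a::euclidean_space set" and h :: "'a \<Rightarrow> real" and I :: "'i set"
  assumes K: "compact K" "connected K" and h: "continuous_on K h" "inj_on h K" "h ` K = {\<alpha>..\<beta>}"
    and st: "\<alpha> < s" "s < t" "t < \<beta>"
    and I: "finite I"
    and sim: "\<And>i x y. i \<in> I \<Longrightarrow> dist (\<phi> i x) (\<phi> i y) = \<rho> i * dist x y"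
    and \<rho>: "\<And>i. i \<in> I \<Longrightarrow> 0 < \<rho> i \<and> \<rho> i < 1" and R: "(\<Sum>i\<in>I. \<rho> i) > 1"
    and sub: "\<And>i. i \<in> I \<Longrightarrow> \<phi> i ` K \<subseteq> K" "\<And>i. i \<in> I \<Longrightarrow> h ` \<phi> i ` K = {u i..v i}"
    and inside: "\<And>i. i \<in> I \<Longrightarrow> s \<le> u i \<and> v i \<le> t"
    and sep: "\<And>i j. i \<in> I \<Longrightarrow> j \<in> I \<Longrightarrow> i \<noteq> j \<Longrightarrow> v i \<le> u j \<or> v j \<le> u i"
  shows "whitney_set K"
proof -
  have "{\<alpha>, s, t, \<beta>} \<subseteq> h ` K" using h(3) st by auto
  then obtain xa xs xb where pts: "xa \<in> K" "xs \<in> K" "xb \<in> K" "h xa = \<alpha>" "h xs = s" "h xb = \<beta>"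
    by auto
  have \<phi>_cont: "continuous_on K (\<phi> i)" and \<phi>_inj: "inj_on (\<phi> i) K" if "i \<in> I" for i
  proof -
    have "(\<rho> i)-lipschitz_on K (\<phi> i)"
      using sim[OF that] \<rho>[OF that] by (intro lipschitz_onI) auto
    then show "continuous_on K (\<phi> i)" by (rule lipschitz_on_continuous_on)
    show "inj_on (\<phi> i) K"
      using sim[OF that] \<rho>[OF that] by (metis dist_eq_0_iff inj_onI mult_eq_0_iff less_irrefl)
  qed
  obtain \<psi> Y \<sigma> BY where \<psi>: "\<And>i. i \<in> I \<Longrightarrow> C1_with_gradient (\<psi> i) (Y i) \<and> (\<forall>x. \<bar>\<psi> i x\<bar> \<le> 1) \<and> (\<forall>x. norm (Y i x) \<le> BY i) \<and> \<bar>\<sigma> i::real\<bar> = 1 \<and>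
    (\<forall>x\<in>K. (h x \<le> u i \<longrightarrow> \<psi> i x = - \<sigma> i) \<and> (v i \<le> h x \<longrightarrow> \<psi> i x = \<sigma> i) \<and>
       (h x \<le> s \<longrightarrow> \<psi> i (\<phi> i x) = -1) \<and> (t \<le> h x \<longrightarrow> \<psi> i (\<phi> i x) = 1) \<and>
       (s \<le> h x \<and> h x \<le> t \<longrightarrow> u i < h (\<phi> i x) \<and> h (\<phi> i x) < v i))"
    using oriented_step_function[OF K(1) h st \<phi>_cont \<phi>_inj sub] by metis
  have \<psi>_C1: "C1_with_gradient (\<psi> i) (Y i)" and \<psi>_le: "\<bar>\<psi> i x\<bar> \<le> 1" and Y_le: "norm (Y i x) \<le> BY i"
    and \<sigma>: "\<bar>\<sigma> i\<bar> = 1" if "i \<in> I" for i x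
    using \<psi>[OF that] by blast+
  have \<psi>_before: "x \<in> K \<Longrightarrow> h x \<le> u i \<Longrightarrow> \<psi> i x = - \<sigma> i"
    and \<psi>_after: "x \<in> K \<Longrightarrow> v i \<le> h x \<Longrightarrow> \<psi> i x = \<sigma> i"
    and \<psi>_first: "x \<in> K \<Longrightarrow> h x \<le> s \<Longrightarrow> \<psi> i (\<phi> i x) = -1"
    and \<psi>_last: "x \<in> K \<Longrightarrow> t \<le> h x \<Longrightarrow> \<psi> i (\<phi> i x) = 1"
    and middle: "x \<in> K \<Longrightarrow> s \<le> h x \<Longrightarrow> h x \<le> t \<Longrightarrow> u i < h (\<phi> i x) \<and> h (\<phi> i x) < v i" if "i \<in> I" for i x
    using \<psi>[OF that] by blast+
  \<comment> \<open>where \<open>\<eta> i\<close> has to be \<open>1\<close>, and where it has to be \<open>0\<close>\<close>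
  define J where "J i = \<phi> i ` {x \<in> K. h x \<in> {s..t}}" for i
  define Z where "Z i = {x \<in> K. h x \<in> {..u i} \<union> {v i..}}" for i
  have "\<exists>\<eta> X B. (\<forall>i\<in>I. C1_with_gradient (\<eta> i) (X i) \<and> range (\<eta> i) \<subseteq> {0..1::real} \<and> (\<forall>x. norm (X i x) \<le> B i) \<and>
      (\<forall>x\<in>J i. \<eta> i x = 1) \<and> (\<forall>x\<in>Z i. \<eta> i x = 0)) \<and>
      (\<forall>i\<in>I. \<forall>j\<in>I. \<forall>x. i \<noteq> j \<longrightarrow> \<eta> i x = 0 \<or> \<eta> j x = 0)"
  proof (rule disjoint_C1_cutoffs)
    fix i assume i: "i \<in> I"
    show "compact (J i)" unfolding J_def
      by (rule compact_continuous_image)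
        (auto intro: continuous_on_subset[OF \<phi>_cont[OF i]] compact_level_set[OF K(1) h(1) closed_atLeastAtMost, of s t, simplified])
    show "J i \<noteq> {}" using pts st unfolding J_def by auto
    show "closed (Z i)" unfolding Z_def
      by (intro compact_imp_closed compact_level_set K h closed_Un closed_atMost closed_atLeast)
    show "Z i \<noteq> {}" using pts st inside[OF i] unfolding Z_def by force
    show "J i \<inter> Z i = {}" using middle[OF i] unfolding J_def Z_def by fastforce
  next
    fix i j assume ij: "i \<in> I" "j \<in> I" "i \<noteq> j"
    show "J j \<subseteq> Z i"
      using middle[OF ij(2)] sep[OF ij] sub(1)[OF ij(2)] unfolding J_def Z_def by fastforce
  qed
  then obtain \<eta> X BX where \<eta>_all: "(\<forall>i\<in>I. C1_with_gradient (\<eta> i) (X i) \<and> range (\<eta> i) \<subseteq> {0..1::real} \<and> (\<forall>x. norm (X i x) \<le> BX i) \<and>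
      (\<forall>x\<in>J i. \<eta> i x = 1) \<and> (\<forall>x\<in>Z i. \<eta> i x = 0)) \<and>
      (\<forall>i\<in>I. \<forall>j\<in>I. \<forall>x. i \<noteq> j \<longrightarrow> \<eta> i x = 0 \<or> \<eta> j x = 0)"
    by (elim exE) (rule that)
  note \<eta> = conjunct1[OF \<eta>_all, rule_format] and \<eta>_disj = conjunct2[OF \<eta>_all, rule_format]
  have "\<exists>\<tau> T. (\<forall>x. \<tau> (\<phi> i x) = x) \<and> linear T \<and> (\<forall>v. norm (T v) = norm v / \<rho> i) \<and>
    (\<forall>f g. C1_with_gradient f g \<longrightarrow> C1_with_gradient (\<lambda>x. f (\<tau> x)) (\<lambda>x. T (g (\<tau> x))))" if i: "i \<in> I" for i
    using similitude_inverse[of "\<phi> i" "\<rho> i", OF sim[OF i]] \<rho>[OF i] by metis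
  then obtain \<tau> T where \<tau>: "\<And>i. i \<in> I \<Longrightarrow> (\<forall>x. \<tau> i (\<phi> i x) = x) \<and> linear (T i) \<and> (\<forall>v. norm (T i v) = norm v / \<rho> i) \<and>
    (\<forall>f g. C1_with_gradient f g \<longrightarrow> C1_with_gradient (\<lambda>x. f (\<tau> i x)) (\<lambda>x. T i (g (\<tau> i x))))"
    by metis
  define r where "r = (\<Sum>i\<in>I. \<rho> i)"
  have r: "r > 1" using R by (simp add: r_def)
  define B where "B = (\<Sum>i\<in>I. \<bar>BX i\<bar> + \<bar>BY i\<bar>)"
  have B: "BX i \<le> B" "BY i \<le> B" if "i \<in> I" for i
  proof -
    have "\<bar>BX i\<bar> + \<bar>BY i\<bar> \<le> B" unfolding B_def using I that by (intro member_le_sum) auto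
    then show "BX i \<le> B" "BY i \<le> B" by auto
  qed
  define q where "q i = \<sigma> i * \<rho> i / r" for i
  define a where "a = {x \<in> K. h x \<in> {..s}}"
  define b where "b = {x \<in> K. h x \<in> {t..}}"
  have qsum: "(\<Sum>i\<in>I. q i * (c * \<sigma> i)) = c" for c
  proof -
    have "(\<Sum>i\<in>I. q i * (c * \<sigma> i)) = (\<Sum>i\<in>I. c / r * \<rho> i)"
    proof (rule sum.cong)
      fix i assume "i \<in> I"
      then have "\<sigma> i * \<sigma> i = 1" using \<sigma>[of i] by (metis abs_mult_self_eq mult_1)
      then show "q i * (c * \<sigma> i) = c / r * \<rho> i" by (simp add: q_def mult_ac)
    qed simp
    also have "\<dots> = c" unfolding sum_distrib_left[symmetric] r_def[symmetric] using r by simp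
    finally show ?thesis .
  qed
  have "\<exists>F G. C1_with_gradient F G \<and> (\<forall>x\<in>a. F x = -1) \<and> (\<forall>x\<in>b. F x = 1) \<and> (\<forall>x\<in>K. G x = 0)"
  proof (rule self_similar_C1_function[where \<theta> = "1 / r" and \<rho> = \<rho> and q = q and \<eta> = \<eta> and X = X and \<psi> = \<psi> and Y = Y and B = B and \<tau> = \<tau> and T = T])
    show "compact a" "compact b" unfolding a_def b_def
      by (intro compact_level_set K h closed_atMost closed_atLeast)+
    show "a \<inter> b = {}" using st by (auto simp: a_def b_def)
    show "0 \<le> 1 / r" "1 / r < 1" using r by auto
  next
    fix i g and f :: "'a \<Rightarrow> real" assume "i \<in> I" "C1_with_gradient f g"
    then show "C1_with_gradient (\<lambda>x. f (\<tau> i x)) (\<lambda>x. T i (g (\<tau> i x)))" using \<tau> by blast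
  next
    fix i assume i: "i \<in> I"
    show "linear (T i)" "0 < \<rho> i \<and> \<rho> i \<le> 1" "C1_with_gradient (\<eta> i) (X i)" "C1_with_gradient (\<psi> i) (Y i)"
      using i \<tau> \<rho>[OF i] \<eta> \<psi>_C1 by auto
    show "\<bar>q i\<bar> \<le> 1 / r * \<rho> i" using \<sigma>[OF i] r \<rho>[OF i] by (simp add: q_def abs_mult)
    fix x
    show "norm (T i x) = norm x / \<rho> i" using \<tau>[OF i] by blast
    show "0 \<le> \<eta> i x \<and> \<eta> i x \<le> 1" using \<eta>[OF i] by (auto simp: image_subset_iff)
    show "norm (X i x) \<le> B" "norm (Y i x) \<le> B" using \<eta>[OF i] Y_le[OF i] B[OF i] by (meson order_trans)+
    show "\<bar>\<psi> i x\<bar> \<le> 1" using \<psi>_le[OF i] .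
    show "\<eta> i x = 0" if "x \<in> a"
    proof -
      have "x \<in> Z i" using that inside[OF i] by (auto simp: a_def Z_def)
      then show ?thesis using \<eta>[OF i] by blast
    qed
    show "\<eta> i x = 0" if "x \<in> b"
    proof -
      have "x \<in> Z i" using that inside[OF i] by (auto simp: b_def Z_def)
      then show ?thesis using \<eta>[OF i] by blast
    qed
    show "(\<eta> i x = 0 \<and> \<bar>\<psi> i x\<bar> = 1) \<or>
          \<tau> i x \<in> K \<and> (\<eta> i x = 1 \<or> \<tau> i x \<in> a \<and> \<psi> i x = -1 \<or> \<tau> i x \<in> b \<and> \<psi> i x = 1)" if x: "x \<in> K"
    proof (cases "x \<in> Z i")
      case True
      then have "h x \<le> u i \<or> v i \<le> h x" by (auto simp: Z_def)
      then have "\<bar>\<psi> i x\<bar> = 1" using \<psi>_before[OF i x] \<psi>_after[OF i x] \<sigma>[OF i] by auto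
      then show ?thesis using \<eta>[OF i] True by blast
    next
      case False
      then have "h x \<in> h ` \<phi> i ` K" using sub(2)[OF i] x by (auto simp: Z_def)
      then obtain y where y: "y \<in> K" "h x = h (\<phi> i y)" by auto
      then have "x = \<phi> i y" using inj_onD[OF h(2)] x sub(1)[OF i] by blast
      then have "\<tau> i x = y" using \<tau>[OF i] by blast
      moreover have "\<eta> i x = 1" if "h y \<in> {s..t}"
        using \<eta>[OF i] that y(1) \<open>x = \<phi> i y\<close> unfolding J_def by blast
      moreover have "h y \<le> s \<or> h y \<in> {s..t} \<or> t \<le> h y" by auto
      ultimately show ?thesis
        using \<psi>_first[OF i y(1)] \<psi>_last[OF i y(1)] y(1) \<open>x = \<phi> i y\<close>
        by (elim disjE) (simp_all add: a_def b_def)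
    qed
  next
    fix x assume x: "x \<in> a"
    have "\<psi> i x = -1 * \<sigma> i" if "i \<in> I" for i
      using \<psi>_before[OF that, of x] x inside[OF that] by (simp add: a_def)
    then have "(\<Sum>i\<in>I. q i * \<psi> i x) = (\<Sum>i\<in>I. q i * (-1 * \<sigma> i))"
      by (intro sum.cong) auto
    then show "(\<Sum>i\<in>I. q i * \<psi> i x) = -1" unfolding qsum .
  next
    fix x assume x: "x \<in> b"
    have "\<psi> i x = 1 * \<sigma> i" if "i \<in> I" for i
      using \<psi>_after[OF that, of x] x inside[OF that] by (simp add: b_def)
    then have "(\<Sum>i\<in>I. q i * \<psi> i x) = (\<Sum>i\<in>I. q i * (1 * \<sigma> i))"
      by (intro sum.cong) auto
    then show "(\<Sum>i\<in>I. q i * \<psi> i x) = 1" unfolding qsum .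
  qed (use I K \<eta>_disj in auto)
  then obtain F G where F: "C1_with_gradient F G" "\<forall>x\<in>a. F x = -1" "\<forall>x\<in>b. F x = 1" "\<forall>x\<in>K. G x = 0"
    by blast
  have "xa \<in> a" "xb \<in> b" using pts st by (auto simp: a_def b_def)
  then have "F xa \<noteq> F xb" using F by simp
  then have "\<not> F constant_on K" using pts unfolding constant_on_def by metis
  then show ?thesis
    using F K unfolding whitney_set_def C1_with_gradient_def by blast
qed

section \<open>Hausdorff dimension and contraction ratios\<close>

lemma diameter_image_similitude_le:
  fixes \<phi> :: "'a::real_normed_vector \<Rightarrow> 'a"
  assumes "\<And>x y. dist (\<phi> x) (\<phi> y) = \<rho> * dist x y" and "0 \<le> \<rho>" and "bounded U"
  shows "bounded (\<phi> ` U)" and "diameter (\<phi> ` U) \<le> \<rho> * diameter U"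
proof -
  have *: "dist (\<phi> x) (\<phi> y) \<le> \<rho> * diameter U" if "x \<in> U" "y \<in> U" for x y
    unfolding assms(1)
    by (intro mult_left_mono diameter_bounded_bound that assms)
  show "bounded (\<phi> ` U)"
    unfolding bounded_two_points using * by blast
  show "diameter (\<phi> ` U) \<le> \<rho> * diameter U"
  proof (rule diameter_le)
    show "\<phi> ` U \<noteq> {} \<or> 0 \<le> \<rho> * diameter U"
      using assms diameter_ge_0 by auto
  qed (use * in \<open>auto simp: dist_norm\<close>)
qed

text \<open>
  Finite covers, given as lists, are padded with empty sets, which contribute \<open>0\<close>.
\<close>
lemma hausdorff_measure_eq_0I:
  fixes A :: "'a::metric_space set"
  assumes "s \<noteq> 0"
    and "\<And>\<delta> \<epsilon>. \<delta> > 0 \<Longrightarrow> \<epsilon> > 0 \<Longrightarrow> \<exists>Us. A \<subseteq> \<Union>(set Us) \<and> (\<forall>U\<in>set Us. bounded U \<and> diameter U \<le> \<delta>)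
             \<and> (\<Sum>U\<leftarrow>Us. diameter U powr s) \<le> \<epsilon>"
  shows "hausdorff_measure s A = 0"
proof -
  have "hausdorff_premeasure s \<delta> A \<le> ennreal \<epsilon>" if pos: "\<delta> > 0" "\<epsilon> > 0" for \<delta> \<epsilon> :: real
  proof -
    obtain Us where Us: "A \<subseteq> \<Union>(set Us)" "\<And>U. U \<in> set Us \<Longrightarrow> bounded U \<and> diameter U \<le> \<delta>"
        "(\<Sum>U\<leftarrow>Us. diameter U powr s) \<le> \<epsilon>"
      using assms(2)[OF pos] by blast
    define V where "V i = (if i < length Us then Us ! i else {})" for i
    have "A \<subseteq> (\<Union>i. V i)"
      using Us(1) by (force simp: V_def in_set_conv_nth)
    moreover have "\<forall>i. bounded (V i) \<and> diameter (V i) \<le> \<delta>"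
      using Us(2) pos by (auto simp: V_def)
    ultimately have "hausdorff_premeasure s \<delta> A \<le> (\<Sum>i. diam_pow s (V i))"
      unfolding hausdorff_premeasure_def by (intro Inf_lower) blast
    also have "\<dots> = (\<Sum>i<length Us. diam_pow s (V i))"
      by (rule suminf_finite) (auto simp: V_def diam_pow_def)
    also have "\<dots> \<le> (\<Sum>i<length Us. ennreal (diameter (Us ! i) powr s))"
      using \<open>s \<noteq> 0\<close> by (intro sum_mono) (auto simp: V_def diam_pow_def)
    also have "\<dots> = ennreal (\<Sum>i<length Us. diameter (Us ! i) powr s)"
      by simp
    also have "(\<Sum>i<length Us. diameter (Us ! i) powr s) = (\<Sum>U\<leftarrow>Us. diameter U powr s)"
      by (simp add: sum_list_sum_nth atLeast0LessThan)
    finally show ?thesis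
      using Us(3) by (meson ennreal_leI order_trans)
  qed
  then have "hausdorff_premeasure s \<delta> A = 0" if "\<delta> > 0" for \<delta>
    using that by (metis ennreal_le_epsilon add.left_neutral le_zero_eq)
  then show ?thesis
    by (auto simp: hausdorff_measure_def intro!: antisym SUP_least)
qed

lemma sum_list_concat_map:
  "(\<Sum>x\<leftarrow>concat (map g xs). f x) = (\<Sum>x\<leftarrow>xs. \<Sum>y\<leftarrow>g x. f y)"
  for f :: "'b \<Rightarrow> 'c::comm_monoid_add"
  by (induction xs) auto

text \<open>
  The cover consists of the images of \<open>E\<close> under the compositions of \<open>n\<close> of the maps; one
  more map multiplies the sum of the powers of the diameters by at most \<open>\<Sum> \<rho>\<^sub>i\<^sup>s\<close>.
\<close>
lemma attractor_cover:
  fixes \<phi> :: "nat \<Rightarrow> 'a::real_normed_vector \<Rightarrow> 'a"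
  assumes sim: "\<And>i x y. i \<in> {1..N} \<Longrightarrow> dist (\<phi> i x) (\<phi> i y) = \<rho> i * dist x y"
    and \<rho>: "\<And>i. i \<in> {1..N} \<Longrightarrow> 0 < \<rho> i \<and> \<rho> i \<le> c"
    and E: "bounded E" "E \<subseteq> (\<Union>i\<in>{1..N}. \<phi> i ` E)" and "0 \<le> s" "0 \<le> c"
  shows "\<exists>Us. E \<subseteq> \<Union>(set Us) \<and> (\<forall>U\<in>set Us. bounded U \<and> diameter U \<le> c ^ n * diameter E)
             \<and> (\<Sum>U\<leftarrow>Us. diameter U powr s) \<le> (\<Sum>i=1..N. \<rho> i powr s) ^ n * diameter E powr s"
proof (induction n)
  case 0
  show ?case using E by (intro exI[of _ "[E]"]) auto
next
  case (Suc n)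
  then obtain Us where Us: "E \<subseteq> \<Union>(set Us)"
     "\<And>U. U \<in> set Us \<Longrightarrow> bounded U \<and> diameter U \<le> c ^ n * diameter E"
     "(\<Sum>U\<leftarrow>Us. diameter U powr s) \<le> (\<Sum>i=1..N. \<rho> i powr s) ^ n * diameter E powr s"
    by blast
  \<comment> \<open>the first map of a word ranges over all indices, the rest is the cover for \<open>n\<close>\<close>
  define Vs where "Vs = concat (map (\<lambda>i. map ((`) (\<phi> i)) Us) [1..<Suc N])"
  have set_Vs: "set Vs = {\<phi> i ` U |i U. i \<in> {1..N} \<and> U \<in> set Us}"
    by (fastforce simp: Vs_def simp del: upt_Suc)
  have img: "bounded (\<phi> i ` U)" "diameter (\<phi> i ` U) \<le> \<rho> i * diameter U"
    if "i \<in> {1..N}" "U \<in> set Us" for i U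
    using diameter_image_similitude_le[of "\<phi> i" "\<rho> i" U] sim[OF that(1)] \<rho>[OF that(1)] Us(2)[OF that(2)]
    by auto
  have cover: "E \<subseteq> \<Union>(set Vs)"
  proof
    fix x assume "x \<in> E"
    then obtain i y where "i \<in> {1..N}" "y \<in> E" "x = \<phi> i y"
      using E(2) by blast
    moreover then obtain U where "U \<in> set Us" "y \<in> U" using Us(1) by blast
    ultimately show "x \<in> \<Union>(set Vs)" unfolding set_Vs by blast
  qed
  have small: "bounded V \<and> diameter V \<le> c ^ Suc n * diameter E" if V: "V \<in> set Vs" for V
  proof -
    obtain i U where iU: "V = \<phi> i ` U" "i \<in> {1..N}" "U \<in> set Us" using V unfolding set_Vs by blast
    have "diameter V \<le> \<rho> i * diameter U" using img iU by simp
    also have "\<dots> \<le> c * (c ^ n * diameter E)"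
      using \<rho>[OF iU(2)] Us(2)[OF iU(3)] \<open>0 \<le> c\<close> by (intro mult_mono diameter_ge_0) auto
    finally show ?thesis using img iU by (simp add: mult.assoc)
  qed
  have "(\<Sum>U\<leftarrow>Vs. diameter U powr s) = (\<Sum>i\<leftarrow>[1..<Suc N]. \<Sum>U\<leftarrow>Us. diameter (\<phi> i ` U) powr s)"
    unfolding Vs_def sum_list_concat_map by (simp add: o_def)
  also have "\<dots> \<le> (\<Sum>i\<leftarrow>[1..<Suc N]. \<Sum>U\<leftarrow>Us. \<rho> i powr s * diameter U powr s)"
  proof (intro sum_list_mono)
    fix i U assume "i \<in> set [1..<Suc N]" and U: "U \<in> set Us"
    then have i: "i \<in> {1..N}" by auto
    have "bounded (\<phi> i ` U)" "diameter (\<phi> i ` U) \<le> \<rho> i * diameter U"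
      using img[OF i U] by auto
    then have "diameter (\<phi> i ` U) powr s \<le> (\<rho> i * diameter U) powr s"
      using \<open>0 \<le> s\<close> diameter_ge_0 powr_mono2 by blast
    also have "\<dots> = \<rho> i powr s * diameter U powr s"
      using \<rho>[OF i] Us(2)[OF U] by (simp add: powr_mult diameter_ge_0)
    finally show "diameter (\<phi> i ` U) powr s \<le> \<rho> i powr s * diameter U powr s" .
  qed
  also have "\<dots> = (\<Sum>i=1..N. \<rho> i powr s) * (\<Sum>U\<leftarrow>Us. diameter U powr s)"
    by (simp add: sum_list_const_mult sum_list_mult_const atLeastLessThanSuc_atLeastAtMost
          interv_sum_list_conv_sum_set_nat del: upt_Suc)
  also have "\<dots> \<le> (\<Sum>i=1..N. \<rho> i powr s) * ((\<Sum>i=1..N. \<rho> i powr s) ^ n * diameter E powr s)"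
    by (intro mult_left_mono Us(3) sum_nonneg) auto
  finally show ?case
    using cover small by (intro exI[of _ Vs]) (auto simp: mult.assoc)
qed

text \<open>
  If the ratios had sum at most \<open>1\<close>, then \<open>\<Sum> \<rho>\<^sub>i\<^sup>s < 1\<close> for every \<open>s > 1\<close>, since each ratio is less than
  \<open>1\<close>, and the natural covers would show that the \<open>s\<close>-dimensional measure of \<open>E\<close> is \<open>0\<close>.
\<close>
lemma sum_ratios_gt_1:
  fixes \<phi> :: "nat \<Rightarrow> 'a::real_normed_vector \<Rightarrow> 'a"
  assumes sim: "\<And>i x y. i \<in> {1..N} \<Longrightarrow> dist (\<phi> i x) (\<phi> i y) = \<rho> i * dist x y"
    and \<rho>: "\<And>i. i \<in> {1..N} \<Longrightarrow> 0 < \<rho> i \<and> \<rho> i < 1"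
    and E: "ifs_attractor N \<phi> E"
    and dim: "hausdorff_dim E > 1"
  shows "(\<Sum>i=1..N. \<rho> i) > 1"
proof (rule ccontr)
  assume "\<not> (\<Sum>i=1..N. \<rho> i) > 1"
  then have le1: "(\<Sum>i=1..N. \<rho> i) \<le> 1" by simp
  have bE: "bounded E" and subE: "E \<subseteq> (\<Union>i\<in>{1..N}. \<phi> i ` E)" and "E \<noteq> {}"
    using E unfolding ifs_attractor_def by (auto simp: compact_imp_bounded)
  then have "{1..N} \<noteq> {}" by auto
  define c where "c = Max (\<rho> ` {1..N})"
  have c: "\<rho> i \<le> c" if "i \<in> {1..N}" for i
    unfolding c_def using that by (intro Max_ge) auto
  have "c \<in> \<rho> ` {1..N}"
    unfolding c_def using \<open>{1..N} \<noteq> {}\<close> by (intro Max_in) auto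
  then have c01: "0 < c" "c < 1" using \<rho> by auto
  have zero: "hausdorff_measure s E = 0" if "s > 1" for s
  proof (rule hausdorff_measure_eq_0I)
    fix \<delta> \<epsilon> :: real assume "\<delta> > 0" "\<epsilon> > 0"
    let ?r = "\<Sum>i=1..N. \<rho> i powr s"
    have "?r < (\<Sum>i=1..N. \<rho> i)"
    proof (rule sum_strict_mono)
      fix i assume "i \<in> {1..N}"
      then show "\<rho> i powr s < \<rho> i"
        using powr_less_mono'[of "\<rho> i" 1 s] \<rho>[of i] \<open>s > 1\<close> by simp
    qed (use \<open>{1..N} \<noteq> {}\<close> in auto)
    then have r: "0 \<le> ?r" "?r < 1" using le1 by (auto intro: sum_nonneg)
    have "(\<lambda>n. c ^ n * diameter E) \<longlonglongrightarrow> 0 * diameter E"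
      using c01 by (intro tendsto_mult LIMSEQ_power_zero tendsto_const) auto
    then have ev1: "\<forall>\<^sub>F n in sequentially. c ^ n * diameter E < \<delta>"
      using \<open>\<delta> > 0\<close> by (intro order_tendstoD) auto
    have "(\<lambda>n. ?r ^ n * diameter E powr s) \<longlonglongrightarrow> 0 * diameter E powr s"
      using r by (intro tendsto_mult LIMSEQ_power_zero tendsto_const) auto
    then have ev2: "\<forall>\<^sub>F n in sequentially. ?r ^ n * diameter E powr s < \<epsilon>"
      using \<open>\<epsilon> > 0\<close> by (intro order_tendstoD) auto
    obtain n where n: "c ^ n * diameter E < \<delta>" "?r ^ n * diameter E powr s < \<epsilon>"
      using eventually_happens[OF eventually_conj[OF ev1 ev2]] by auto
    obtain Us where "E \<subseteq> \<Union>(set Us)"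
      "\<forall>U\<in>set Us. bounded U \<and> diameter U \<le> c ^ n * diameter E"
      "(\<Sum>U\<leftarrow>Us. diameter U powr s) \<le> ?r ^ n * diameter E powr s"
      using attractor_cover[where N = N and \<phi> = \<phi> and \<rho> = \<rho> and c = c and E = E and s = s and n = n, OF sim] \<rho> c bE subE \<open>s > 1\<close> c01 by auto
    with n show "\<exists>Us. E \<subseteq> \<Union>(set Us) \<and> (\<forall>U\<in>set Us. bounded U \<and> diameter U \<le> \<delta>)
             \<and> (\<Sum>U\<leftarrow>Us. diameter U powr s) \<le> \<epsilon>"
      by (intro exI[of _ Us]) force
  qed (use that in simp)
  have "hausdorff_dim E \<le> ennreal (1 + e)" if "e > 0" for e
    unfolding hausdorff_dim_def using zero[of "1 + e"] that by (intro Inf_lower) (auto intro!: exI[of _ "1 + e"])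
  then have "hausdorff_dim E \<le> 1 + ennreal e" if "e > 0" for e
    using that by (metis add.commute ennreal_1 ennreal_plus less_eq_real_def zero_le_one)
  then have "hausdorff_dim E \<le> 1"
    by (rule ennreal_le_epsilon)
  with dim show False by simp
qed

section \<open>Attractors with condensation\<close>

text \<open>
  For the rearrangement hypothesis: the pieces of an arc are distinct sets, so no set occurs twice on
  either side of the equation of multisets.
\<close>
lemma inj_on_of_image_mset_subset:
  assumes "finite I" and sub: "image_mset f (mset_set I) \<subseteq># mset_set B"
  shows "inj_on f I"
proof (rule inj_onI, rule ccontr)
  fix i j assume ij: "i \<in> I" "j \<in> I" "f i = f j" "i \<noteq> j"
  have "card {i, j} \<le> card (f -` {f i} \<inter> I)"
    using ij \<open>finite I\<close> by (intro card_mono) auto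
  also have "\<dots> = count (image_mset f (mset_set I)) (f i)"
    using \<open>finite I\<close> by (simp add: count_image_mset)
  also have "\<dots> \<le> count (mset_set B) (f i)"
    using sub by (rule mset_subset_eq_count)
  also have "\<dots> \<le> 1" by (simp add: count_mset_set')
  finally show False using ij by simp
qed

lemma disjoint_of_sum_eq_mset_set:
  assumes "M + M' = mset_set B" and "x \<in># M" shows "x \<notin># M'"
proof
  assume "x \<in># M'"
  then have "count (M + M') x \<ge> 2" using assms(2) by (simp add: count_greater_zero_iff[symmetric] del: count_greater_zero_iff)
  then show False using assms(1) by (simp add: count_mset_set' split: if_splits)
qed

theorem theorem1p1:
  fixes \<phi> :: "nat \<Rightarrow> real ^ 'n \<Rightarrow> real ^ 'n"
    and C \<gamma> :: "nat \<Rightarrow> (real ^ 'n) set"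
    and K E :: "(real ^ 'n) set"
    and m N :: nat
  assumes "\<And>i. i \<in> {1..N} \<Longrightarrow> contractive_similitude (\<phi> i)"
    and "m \<ge> 2"
    and "\<And>j. j \<in> {1..m} \<Longrightarrow> is_arc (C j)"
    and "disjoint_family_on C {1..m}"
    and "condensation_attractor (\<Union>j\<in>{1..m}. C j) N \<phi> K"
    and "ifs_attractor N \<phi> E"
    and "is_arc K"
    and "arc_decomposition K \<gamma> (m + N)"
    and "{#\<gamma> l. l \<in># mset_set {1..m + N}#} =
           {#C j. j \<in># mset_set {1..m}#} + {#\<phi> i ` K. i \<in># mset_set {1..N}#}"
    and "\<gamma> 1 \<in> C ` {1..m}" and "\<gamma> (m + N) \<in> C ` {1..m}"
    and "hausdorff_dim E > 1"
  shows "whitney_set K"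
proof -
  define n where "n = m + N"
  have n: "n \<ge> 1" using \<open>m \<ge> 2\<close> by (simp add: n_def)
  note dec = \<open>arc_decomposition K \<gamma> (m + N)\<close>[folded n_def]
  obtain h :: "real ^ 'n \<Rightarrow> real" and t where h: "continuous_on K h" "inj_on h K"
    and t: "\<And>l. l \<in> {1..n} \<Longrightarrow> t (l - 1) < t l \<and> \<gamma> l \<subseteq> K \<and> h ` \<gamma> l = {t (l - 1)..t l}"
    using decomposition_chart[OF dec n] by metis
  have t_less: "t k < t l" if "k < l" "l \<le> n" for k l
    using that
  proof (induction l)
    case (Suc l)
    then show ?case using t[of "Suc l"] by (cases "k = l") force+
  qed simp
  have t_le: "t k \<le> t l" if "k \<le> l" "l \<le> n" for k l
    using t_less[of k l] that by (cases "k = l") auto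
  have K_Un: "K = (\<Union>l\<in>{1..n}. \<gamma> l)"
    using dec unfolding arc_decomposition_def by blast
  have "{t 0..t k} \<subseteq> h ` K" if "1 \<le> k" "k \<le> n" for k
    using that
  proof (induction k rule: dec_induct)
    case base
    have "{t 0..t 1} = h ` \<gamma> 1" "\<gamma> 1 \<subseteq> K" using t[of 1] n by simp_all
    then show ?case by (metis image_mono)
  next
    case (step k)
    have "{t 0..t (Suc k)} \<subseteq> {t 0..t k} \<union> {t k..t (Suc k)}" by auto
    moreover have "{t k..t (Suc k)} = h ` \<gamma> (Suc k)" "\<gamma> (Suc k) \<subseteq> K" using t[of "Suc k"] step by simp_all
    then have "{t k..t (Suc k)} \<subseteq> h ` K" by (metis image_mono)
    ultimately show ?case using step by auto
  qed
  from this[OF n order_refl] have "{t 0..t n} \<subseteq> h ` K" .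
  moreover have "h x \<in> {t 0..t n}" if x: "x \<in> K" for x
  proof -
    obtain l where l: "l \<in> {1..n}" "x \<in> \<gamma> l" using x K_Un by blast
    then have "h x \<in> {t (l - 1)..t l}" using t by blast
    moreover have "t 0 \<le> t (l - 1)" "t l \<le> t n" using l(1) by (auto intro!: t_le)
    ultimately show ?thesis by auto
  qed
  ultimately have hK: "h ` K = {t 0..t n}" by blast
  have inj_\<gamma>: "inj_on \<gamma> {1..n}"
  proof (rule linorder_inj_onI)
    fix k l assume "k < l" "k \<in> {1..n}" "l \<in> {1..n}"
    then show "\<gamma> k \<noteq> \<gamma> l"
      using t[of k] t[of l] t_less[of k l] by (metis Icc_eq_Icc atLeastAtMost_iff less_irrefl less_imp_le)
  qed auto
  have pieces: "{#C j. j \<in># mset_set {1..m}#} + {#\<phi> i ` K. i \<in># mset_set {1..N}#} = mset_set (\<gamma> ` {1..n})"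
    using assms(9) image_mset_mset_set[OF inj_\<gamma>] by (simp add: n_def)
  \<comment> \<open>different indices \<open>i\<close> have different copies \<open>\<phi> i ` K\<close>, hence different positions \<open>l i\<close>\<close>
  have inj_copies: "inj_on (\<lambda>i. \<phi> i ` K) {1..N}"
    by (rule inj_on_of_image_mset_subset[of _ _ "\<gamma> ` {1..n}"]) (unfold pieces[symmetric], simp_all)
  have "\<exists>l\<in>{1..n}. \<phi> i ` K = \<gamma> l" if "i \<in> {1..N}" for i
  proof -
    have "\<phi> i ` K \<in># {#C j. j \<in># mset_set {1..m}#} + {#\<phi> i ` K. i \<in># mset_set {1..N}#}"
      using that by simp
    then have "\<phi> i ` K \<in> \<gamma> ` {1..n}" unfolding pieces by simp
    then show ?thesis by blast
  qed
  then obtain l where l: "\<And>i. i \<in> {1..N} \<Longrightarrow> l i \<in> {1..n} \<and> \<phi> i ` K = \<gamma> (l i)"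
    by metis
  have inside: "1 < l i \<and> l i < n" if i: "i \<in> {1..N}" for i
  proof -
    have "\<gamma> (l i) \<in># {#\<phi> i ` K. i \<in># mset_set {1..N}#}"
      using conjunct2[OF l[OF i], symmetric] i by simp
    then have "\<not> \<gamma> (l i) \<in># {#C j. j \<in># mset_set {1..m}#}"
      using disjoint_of_sum_eq_mset_set[OF pieces] by blast
    then have "\<gamma> (l i) \<notin> C ` {1..m}" by simp
    then have "l i \<noteq> 1" "l i \<noteq> n" using assms(10,11) by (auto simp: n_def)
    then show ?thesis using l[OF i] by auto
  qed
  obtain \<rho> where \<rho>: "\<And>i. i \<in> {1..N} \<Longrightarrow> \<rho> i \<in> {0<..<1} \<and> (\<forall>x y. dist (\<phi> i x) (\<phi> i y) = \<rho> i * dist x y)"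
    using assms(1) unfolding contractive_similitude_def by metis
  have "(\<Sum>i=1..N. \<rho> i) > 1"
    by (rule sum_ratios_gt_1[of N \<phi>]) (use \<rho> assms in auto)
  then obtain i where "i \<in> {1..N}" by (metis ex_in_conv not_one_less_zero sum.empty)
  \<comment> \<open>some copy lies strictly between the first and the last piece, so the middle part is nondegenerate\<close>
  then have n3: "1 < n - 1" using inside[of i] by auto
  show ?thesis
  proof (rule whitney_set_of_self_similar_arc[where I = "{1..N}" and s = "t 1" and t = "t (n - 1)" and \<phi> = \<phi> and \<rho> = \<rho>
        and u = "\<lambda>i. t (l i - 1)" and v = "\<lambda>i. t (l i)", OF _ _ h hK])
    show "compact K" using assms(5) unfolding condensation_attractor_def by blast
    show "connected K"
      using \<open>is_arc K\<close> homeomorphic_connectedness[of "{0..1::real}" K] unfolding is_arc_def by simp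
    show "t 0 < t 1" "t 1 < t (n - 1)" "t (n - 1) < t n"
      using n3 by (auto intro: t_less)
    show "(\<Sum>i\<in>{1..N}. \<rho> i) > 1" by fact
  next
    fix i assume i: "i \<in> {1..N}"
    show "0 < \<rho> i \<and> \<rho> i < 1" using \<rho>[OF i] by simp
    show "dist (\<phi> i x) (\<phi> i y) = \<rho> i * dist x y" for x y using \<rho>[OF i] by blast
    show "\<phi> i ` K \<subseteq> K" using l[OF i] t by simp
    show "h ` \<phi> i ` K = {t (l i - 1)..t (l i)}" using l[OF i] t by simp
    show "t 1 \<le> t (l i - 1) \<and> t (l i) \<le> t (n - 1)" using inside[OF i] by (auto intro!: t_le)
  next
    fix i j assume ij: "i \<in> {1..N}" "j \<in> {1..N}" "i \<noteq> j"
    then have "l i \<noteq> l j" using l inj_onD[OF inj_copies, of i j] by metis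
    then show "t (l i) \<le> t (l j - 1) \<or> t (l j) \<le> t (l i - 1)"
      using inside ij t_le[of "l i" "l j - 1"] t_le[of "l j" "l i - 1"] by (cases "l i < l j") force+
  qed simp
qed

end
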